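(* For $(a,b)\in\mathbb{R}^2$, let $H_{(a,b,3)}$ denote the polynomial system $x^{6}+ay^3-y=0$, $y^{6}+bx^3-x=0$, and let $E_3\subseteq\mathbb{R}^2$ be the set of all $(a,b)$ such that $H_{(a,b,3)}$ has at least $5$ non-degenerate isolated roots in the open positive quadrant $\mathbb{R}^2_+=\{(x,y):x>0,\ y>0\}$. Then $E_3$ is non-empty and star convex. In particular, $\left(\frac{44}{31},\frac{44}{31}\right)\in E_3$, and the system $x^6+\frac{44}{31}y^3-y=0,\ y^6+\frac{44}{31}x^3-x=0$ has exactly $5$ roots in $\mathbb{R}^2_+$, all of them non-degenerate.
   Context: A set $S\subset\mathbb{R}^n$ is star convex if there is a point $p\in S$ such that for every $x\in S$ the closed line segment from $p$ to $x$ is contained in $S$. A root of a square polynomial system is non-degenerate if the Jacobian matrix of the system is invertible at that root. *)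

theory Defs
  imports "HOL-Analysis.Analysis"
begin

definition H3 :: "real \<Rightarrow> real \<Rightarrow> real \<times> real \<Rightarrow> real \<times> real" where
  "H3 a b p = (let x = fst p; y = snd p in (x^6 + a * y^3 - y, y^6 + b * x^3 - x))"

definition root3 :: "real \<Rightarrow> real \<Rightarrow> real \<times> real \<Rightarrow> bool" where
  "root3 a b p \<longleftrightarrow> H3 a b p = (0, 0)"

definition jac3 :: "real \<Rightarrow> real \<Rightarrow> real \<times> real \<Rightarrow> real^2^2" where
  "jac3 a b p = (let x = fst p; y = snd p in
     vector [vector [6 * x^5, 3 * a * y^2 - 1],
             vector [3 * b * x^2 - 1, 6 * y^5]])"

definition nondegenerate3 :: "real \<Rightarrow> real \<Rightarrow> real \<times> real \<Rightarrow> bool" where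
  "nondegenerate3 a b p \<longleftrightarrow> root3 a b p \<and> invertible (jac3 a b p)"

definition isolated_root3 :: "real \<Rightarrow> real \<Rightarrow> real \<times> real \<Rightarrow> bool" where
  "isolated_root3 a b p \<longleftrightarrow> root3 a b p \<and>
     (\<exists>e>0. \<forall>q. root3 a b q \<and> dist q p < e \<longrightarrow> q = p)"

definition pos_quadrant :: "(real \<times> real) set" where
  "pos_quadrant = {p. fst p > 0 \<and> snd p > 0}"

definition E3 :: "(real \<times> real) set" where
  "E3 = {(a, b). \<exists>R. finite R \<and> card R \<ge> 5 \<and> R \<subseteq> pos_quadrant \<and>
            (\<forall>p\<in>R. nondegenerate3 a b p \<and> isolated_root3 a b p)}"

end

theory Submission
  imports Defs "HOL-Real_Asymp.Real_Asymp"
begin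

text \<open>
  With \<open>u = x\<^sup>6/y\<close> and \<open>v = y\<^sup>6/x\<close> a positive root satisfies \<open>1 - u = a y\<^sup>2\<close> and
  \<open>1 - v = b x\<^sup>2\<close>, so for \<open>a, b > 0\<close> taking logarithms gives
  \<open>35 ln (1 - u) - 2 ln u - 12 ln v = 35 ln a\<close> together with its mirror image; if \<open>a \<le> 0\<close> or
  \<open>b \<le> 0\<close> there is at most one positive root.  A root is degenerate iff
  \<open>27uv + 6(u + v) = 4\<close>, which makes the discriminant a curve rationally parametrised by
  \<open>u \<in> (0, 2/3)\<close>; along it \<open>d(ln a)/du\<close> vanishes at exactly three cusps, so \<open>ln a\<close> is monotone on
  four branches.  Eliminating \<open>v\<close> leaves a function of \<open>u\<close> whose critical points are the points
  of the discriminant over the given \<open>a\<close>, whence five roots occur exactly when all four branches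
  lie over \<open>a\<close> and the values of \<open>b\<close> on them are alternately above and below the given \<open>b\<close>.

  On the first two branches the ratio \<open>b/a\<close> increases with \<open>a\<close>, on the last two it decreases.  As the
  region is symmetric in the diagonal, it suffices to treat points with \<open>a \<le> b\<close>, and there only the
  first and third branch matter.  Taking as centre the diagonal point below the intersection of
  these two branches, the monotonicity of \<open>a\<close>, \<open>b\<close> and \<open>b/a\<close> along the branches shows that
  segments to the centre stay inside.
\<close>

subsection \<open>The discriminant curve\<close>

text \<open>At the point of the discriminant with parameter \<open>u\<close>, the other coordinate is \<open>v = crit_v u\<close>,
  and \<open>log_a u\<close>, \<open>log_b u\<close> are \<open>35 ln a\<close>, \<open>35 ln b\<close>; \<open>cusp1\<close>, \<open>2/9\<close> and \<open>cusp3\<close> are its cusps.\<close>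
definition crit_v :: "real \<Rightarrow> real" where
  "crit_v u = (4 - 6 * u) / (27 * u + 6)"

definition log_a :: "real \<Rightarrow> real" where
  "log_a u = 35 * ln (1 - u) - 2 * ln u - 12 * ln (crit_v u)"

definition log_b :: "real \<Rightarrow> real" where
  "log_b u = log_a (crit_v u)"

definition cusp1 :: real where "cusp1 = (8 - 2 * sqrt 5) / 33"
definition cusp3 :: real where "cusp3 = (8 + 2 * sqrt 5) / 33"

lemma cusp_bounds: "1/11 < cusp1" "cusp1 < 2/9" "2/9 < cusp3" "cusp3 < 2/3"
proof -
  have "sqrt 5 < 5/2" by (rule real_less_lsqrt) (auto simp: power2_eq_square)
  moreover have "2 < sqrt 5" by (rule real_less_rsqrt) auto
  ultimately show "1/11 < cusp1" "cusp1 < 2/9" "2/9 < cusp3" "cusp3 < 2/3"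
    by (auto simp: cusp1_def cusp3_def)
qed

lemma cusp_poly: "99 * u^2 - 48 * u + 4 = 99 * (u - cusp1) * (u - cusp3)"
  by (simp add: cusp1_def cusp3_def field_simps power2_eq_square)

lemma crit_v_cusp1: "crit_v cusp1 = cusp3" and crit_v_cusp3: "crit_v cusp3 = cusp1"
proof -
  have "27 * cusp1 * cusp3 + 6 * (cusp1 + cusp3) = 4"
    by (simp add: cusp1_def cusp3_def field_simps)
  then show "crit_v cusp1 = cusp3" "crit_v cusp3 = cusp1"
    using cusp_bounds by (auto simp: crit_v_def field_simps)
qed

lemma crit_v_mid: "crit_v (2/9) = 2/9"
  by (simp add: crit_v_def)

lemma crit_v_bounds:
  assumes "0 < u" "u < 2/3"
  shows "0 < crit_v u" "crit_v u < 2/3"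
  using assms by (auto simp: crit_v_def field_simps)

text \<open>\<open>crit_v u\<close> is the solution \<open>v\<close> of
  \<open>27uv + 6(u + v) = 4\<close>, an equation symmetric in \<open>u\<close> and
  \<open>v\<close>.\<close>

lemma crit_v_invol:
  assumes "0 < u" "u < 2/3"
  shows "crit_v (crit_v u) = u"
proof -
  have "27 * u + 6 > 0" using assms by simp
  then have "4 - 6 * crit_v u = 144 * u / (27 * u + 6)" "27 * crit_v u + 6 = 144 / (27 * u + 6)"
    by (auto simp: crit_v_def field_simps)
  then show ?thesis
    using \<open>27 * u + 6 > 0\<close> by (simp add: crit_v_def[of "crit_v u"])
qed

lemma crit_v_less:
  assumes "0 < u" "u < w"
  shows "crit_v w < crit_v u"
  using assms by (auto simp: crit_v_def divide_simps algebra_simps)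

lemma log_b_eq:
  assumes "0 < u" "u < 2/3"
  shows "log_b u = 35 * ln (1 - crit_v u) - 2 * ln (crit_v u) - 12 * ln u"
  using assms by (simp add: log_b_def log_a_def crit_v_invol)

text \<open>Up to a constant this is the numerator of the derivative of \<open>log_a\<close>. The
  factored form shows the sign on each branch; \<open>cusp_cubic_eq\<close> gives the expanded form
  that differentiation produces.\<close>

definition cusp_cubic :: "real \<Rightarrow> real" where
  "cusp_cubic u = (9 * u - 2) * (u - cusp1) * (u - cusp3)"

lemma cusp_cubic_eq: "99 * cusp_cubic u = 891*u^3 - 630*u^2 + 132*u - 8"
proof -
  have "99 * cusp_cubic u = (9 * u - 2) * (99 * (u - cusp1) * (u - cusp3))"
    by (simp add: cusp_cubic_def)
  also have "\<dots> = (9 * u - 2) * (99 * u^2 - 48 * u + 4)"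
    by (simp only: cusp_poly)
  finally show ?thesis by (simp add: algebra_simps power2_eq_square power3_eq_cube)
qed

definition log_a_slope :: "real \<Rightarrow> real" where
  "log_a_slope u = 99 * cusp_cubic u / (u * (1 - u) * (2 - 3 * u) * (9 * u + 2))"

lemma log_a_slope_sign:
  assumes "0 < u" "u < 2/3"
  shows "log_a_slope u > 0 \<longleftrightarrow> cusp_cubic u > 0" "log_a_slope u < 0 \<longleftrightarrow> cusp_cubic u < 0"
proof -
  have "u * (1 - u) * (2 - 3 * u) * (9 * u + 2) > 0" using assms by simp
  then show "log_a_slope u > 0 \<longleftrightarrow> cusp_cubic u > 0" "log_a_slope u < 0 \<longleftrightarrow> cusp_cubic u < 0"
    unfolding log_a_slope_def by (simp_all add: zero_less_divide_iff divide_less_0_iff)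
qed

section \<open>Derivatives along the discriminant curve\<close>

lemma crit_v_deriv:
  assumes "0 < u"
  shows "(crit_v has_real_derivative - 144 / (27 * u + 6)^2) (at u)"
  unfolding crit_v_def[abs_def]
  by (rule derivative_eq_intros refl | use assms in \<open>simp add: power2_eq_square field_simps\<close>)+

lemma log_a_deriv:
  assumes u: "0 < u" "u < 2/3"
  shows "(log_a has_real_derivative log_a_slope u) (at u)"
proof -
  have pos: "27 * u + 6 > 0" "9 * u + 2 > 0" "2 - 3 * u > 0" "1 - u > 0" using u by auto
  have v: "0 < crit_v u" using crit_v_bounds[OF u] by simp
  have "(log_a has_real_derivative
           (- 35 / (1 - u) - 2 / u - 12 * ((- 144 / (27 * u + 6)^2) / crit_v u))) (at u)"
    unfolding log_a_def[abs_def]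
    using u v by (auto intro!: derivative_eq_intros crit_v_deriv simp: field_simps)
  moreover have "12 * ((- 144 / (27 * u + 6)^2) / crit_v u) = - 288 / ((2 - 3 * u) * (9 * u + 2))"
    using pos by (simp add: crit_v_def divide_simps power2_eq_square) (simp add: algebra_simps)
  moreover have "- 35 / (1 - u) - 2 / u - (- 288 / ((2 - 3 * u) * (9 * u + 2)))
      = 99 * cusp_cubic u / (u * (1 - u) * (2 - 3 * u) * (9 * u + 2))"
    unfolding cusp_cubic_eq using pos u
    by (simp add: divide_simps) (simp add: algebra_simps power2_eq_square power3_eq_cube)
  ultimately show ?thesis by (simp add: log_a_slope_def)
qed

text \<open>The factor \<open>12(1 - u)/(33u + 2)\<close> is the slope of the curve in logarithmic
  coordinates. It is positive, so \<open>log_b\<close> rises and falls together with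
  \<open>log_a\<close>, and it equals 1 at \<open>u = 2/9\<close>.\<close>

lemma log_b_deriv:
  assumes u: "0 < u" "u < 2/3"
  shows "(log_b has_real_derivative log_a_slope u * (12 * (1 - u) / (33 * u + 2))) (at u)"
proof -
  define v where "v = crit_v u"
  have v: "0 < v" "v < 2/3" using crit_v_bounds[OF u] by (auto simp: v_def)
  have pos: "27 * u + 6 > 0" "9 * u + 2 > 0" "2 - 3 * u > 0" "1 - u > 0" "33 * u + 2 > 0"
    using u by auto
  have "((\<lambda>u. 35 * ln (1 - crit_v u) - 2 * ln (crit_v u) - 12 * ln u) has_real_derivative
      144 / (27 * u + 6)^2 * (35 / (1 - v) + 2 / v) - 12 / u) (at u)"
    using u v unfolding v_def
    by (auto intro!: derivative_eq_intros crit_v_deriv simp: field_simps)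
  then have "(log_b has_real_derivative
      144 / (27 * u + 6)^2 * (35 / (1 - v) + 2 / v) - 12 / u) (at u)"
    by (rule has_field_derivative_transform_within_open[of _ _ _ "{0<..<2/3}"])
       (use u in \<open>auto simp: log_b_eq\<close>)
  moreover have "144 / (27 * u + 6)^2 * (35 / (1 - v) + 2 / v) - 12 / u
      = log_a_slope u * (12 * (1 - u) / (33 * u + 2))"
  proof -
    have "35 / (1 - v) + 2 / v = (33 * v + 2) / (v * (1 - v))"
      using v by (simp add: field_simps)
    \<comment> \<open>Passing from \<open>u\<close> to \<open>v = crit_v u\<close> exchanges
      \<open>33u + 2\<close> and \<open>1 - u\<close> up to constants and the denominator
      \<open>27u + 6\<close>.\<close>
    also have "\<dots> = (144 * (1 - u) / (27 * u + 6)) /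
        ((4 - 6 * u) / (27 * u + 6) * ((33 * u + 2) / (27 * u + 6)))"
    proof -
      have "33 * v + 2 = 144 * (1 - u) / (27 * u + 6)" "1 - v = (33 * u + 2) / (27 * u + 6)"
        using pos by (auto simp: v_def crit_v_def field_simps)
      then show ?thesis by (simp add: v_def crit_v_def)
    qed
    finally have "144 / (27 * u + 6)^2 * (35 / (1 - v) + 2 / v)
        = 144 / (27 * u + 6)^2 * ((144 * (1 - u) / (27 * u + 6)) /
            ((4 - 6 * u) / (27 * u + 6) * ((33 * u + 2) / (27 * u + 6))))"
      by (simp only:)
    also have "\<dots> = 12 * 288 * (1 - u) / ((9 * u + 2) * (2 - 3 * u) * (33 * u + 2))"
      using pos by (simp add: divide_simps power2_eq_square) (simp add: algebra_simps)
    also have "\<dots> - 12 / u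
        = 12 * (99 * cusp_cubic u) / (u * (2 - 3 * u) * (9 * u + 2) * (33 * u + 2))"
      unfolding cusp_cubic_eq using pos u
      by (simp add: divide_simps) (simp add: algebra_simps power2_eq_square power3_eq_cube)
    also have "\<dots> = log_a_slope u * (12 * (1 - u) / (33 * u + 2))"
      using pos u by (simp add: log_a_slope_def divide_simps)
    finally show ?thesis .
  qed
  ultimately show ?thesis by simp
qed

text \<open>This is \<open>35 ln (b/a)\<close> on the curve, so its level sets are rays through the
  origin of the \<open>(a, b)\<close> plane.\<close>

definition log_ratio :: "real \<Rightarrow> real" where
  "log_ratio u = log_b u - log_a u"

text \<open>The logarithmic slope minus 1 is \<open>5(2 - 9u)/(33u + 2)\<close>, which changes sign
  at the middle cusp. Hence \<open>b/a\<close> moves with \<open>a\<close> before \<open>2/9\<close>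
  and against it afterwards.\<close>

lemma log_ratio_deriv:
  assumes u: "0 < u" "u < 2/3"
  shows "(log_ratio has_real_derivative log_a_slope u * (5 * (2 - 9 * u) / (33 * u + 2))) (at u)"
proof -
  define d where "d = log_a_slope u"
  have "(log_ratio has_real_derivative d * (12 * (1 - u) / (33 * u + 2)) - d) (at u)"
    unfolding log_ratio_def[abs_def] d_def
    by (rule DERIV_diff[OF log_b_deriv[OF u] log_a_deriv[OF u]])
  moreover have "d * (12 * (1 - u) / (33 * u + 2)) - d = d * (5 * (2 - 9 * u) / (33 * u + 2))"
    using u by (simp add: field_simps)
  ultimately show ?thesis by (simp add: d_def)
qed

lemma log_cont:
  assumes "S \<subseteq> {0<..<2/3}"
  shows "continuous_on S log_a" "continuous_on S log_b" "continuous_on S log_ratio"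
proof -
  have S: "0 < u" "u < 2/3" if "u \<in> S" for u using that assms by auto
  show "continuous_on S log_a" "continuous_on S log_b" "continuous_on S log_ratio"
    using DERIV_isCont[OF log_a_deriv[OF S]] DERIV_isCont[OF log_b_deriv[OF S]]
      DERIV_isCont[OF log_ratio_deriv[OF S]]
    by (auto intro: continuous_at_imp_continuous_on)
qed

section \<open>Monotonicity of \<open>a\<close>, \<open>b\<close> and \<open>b/a\<close> on the
  branches between cusps\<close>

lemma cusp_cubic_neg1: "u < cusp1 \<Longrightarrow> cusp_cubic u < 0"
  using cusp_bounds unfolding cusp_cubic_def by (auto intro!: mult_pos_neg mult_neg_neg)

lemma cusp_cubic_pos2: "cusp1 < u \<Longrightarrow> u < 2/9 \<Longrightarrow> cusp_cubic u > 0"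
  using cusp_bounds unfolding cusp_cubic_def by (auto intro!: mult_neg_neg mult_neg_pos)

lemma cusp_cubic_neg3: "2/9 < u \<Longrightarrow> u < cusp3 \<Longrightarrow> cusp_cubic u < 0"
  using cusp_bounds unfolding cusp_cubic_def by (auto intro!: mult_pos_neg mult_pos_pos)

lemma cusp_cubic_pos4: "cusp3 < u \<Longrightarrow> cusp_cubic u > 0"
  using cusp_bounds unfolding cusp_cubic_def by (auto intro!: mult_pos_pos)

text \<open>One sign condition serves both coordinates because the logarithmic slope is positive. It
  is required only in the open interval, so a branch may include its end cusps.\<close>

lemma log_increasing:
  assumes "0 < u" "u < w" "w < 2/3" and pos: "\<And>t. u < t \<Longrightarrow> t < w \<Longrightarrow> cusp_cubic t > 0"
  shows "log_a u < log_a w" "log_b u < log_b w"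
proof -
  have cont: "continuous_on {u..w} log_a" "continuous_on {u..w} log_b"
    using assms by (auto intro!: log_cont)
  show "log_a u < log_a w"
    using \<open>u < w\<close>
  proof (rule DERIV_pos_imp_increasing_open[OF _ _ cont(1)])
    fix t assume "u < t" "t < w"
    then show "\<exists>y. (log_a has_real_derivative y) (at t) \<and> y > 0"
      using log_a_deriv[of t] log_a_slope_sign[of t] assms by (metis less_trans)
  qed
  show "log_b u < log_b w"
    using \<open>u < w\<close>
  proof (rule DERIV_pos_imp_increasing_open[OF _ _ cont(2)])
    fix t assume "u < t" "t < w"
    then have t: "0 < t" "t < 2/3" "log_a_slope t > 0"
      using log_a_slope_sign[of t] assms by auto
    then have "log_a_slope t * (12 * (1 - t) / (33 * t + 2)) > 0"
      by (intro mult_pos_pos divide_pos_pos) auto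
    then show "\<exists>y. (log_b has_real_derivative y) (at t) \<and> y > 0"
      using log_b_deriv[OF t(1,2)] by blast
  qed
qed

lemma log_decreasing:
  assumes "0 < u" "u < w" "w < 2/3" and neg: "\<And>t. u < t \<Longrightarrow> t < w \<Longrightarrow> cusp_cubic t < 0"
  shows "log_a w < log_a u" "log_b w < log_b u"
proof -
  have cont: "continuous_on {u..w} log_a" "continuous_on {u..w} log_b"
    using assms by (auto intro!: log_cont)
  show "log_a w < log_a u"
    using \<open>u < w\<close>
  proof (rule DERIV_neg_imp_decreasing_open[OF _ _ cont(1)])
    fix t assume "u < t" "t < w"
    then show "\<exists>y. (log_a has_real_derivative y) (at t) \<and> y < 0"
      using log_a_deriv[of t] log_a_slope_sign[of t] assms by (metis less_trans)
  qed
  show "log_b w < log_b u"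
    using \<open>u < w\<close>
  proof (rule DERIV_neg_imp_decreasing_open[OF _ _ cont(2)])
    fix t assume "u < t" "t < w"
    then have t: "0 < t" "t < 2/3" "log_a_slope t < 0"
      using log_a_slope_sign[of t] assms by auto
    then have "log_a_slope t * (12 * (1 - t) / (33 * t + 2)) < 0"
      by (intro mult_neg_pos divide_pos_pos) auto
    then show "\<exists>y. (log_b has_real_derivative y) (at t) \<and> y < 0"
      using log_b_deriv[OF t(1,2)] by blast
  qed
qed

lemma log_branch1:
  assumes "0 < u" "u < w" "w \<le> cusp1"
  shows "log_a w < log_a u" "log_b w < log_b u"
  using assms cusp_bounds by (auto intro!: log_decreasing cusp_cubic_neg1)

lemma log_branch1_rev:
  assumes "0 < u" "u \<le> cusp1" "0 < w" "w \<le> cusp1" "log_a u < log_a w"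
  shows "w < u"
  using log_branch1(1)[of u w] assms by (cases u w rule: linorder_cases) auto

lemma log_branch2:
  assumes "cusp1 \<le> u" "u < w" "w \<le> 2/9"
  shows "log_a u < log_a w" "log_b u < log_b w"
  using assms cusp_bounds by (auto intro!: log_increasing cusp_cubic_pos2)

lemma log_branch3:
  assumes "2/9 \<le> u" "u < w" "w \<le> cusp3"
  shows "log_a w < log_a u" "log_b w < log_b u"
  using assms cusp_bounds by (auto intro!: log_decreasing cusp_cubic_neg3)

lemma log_branch4:
  assumes "cusp3 \<le> u" "u < w" "w < 2/3"
  shows "log_a u < log_a w" "log_b u < log_b w"
  using assms cusp_bounds by (auto intro!: log_increasing cusp_cubic_pos4)

lemma log_ratio_branch1:
  assumes "0 < u" "u < w" "w \<le> cusp1"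
  shows "log_ratio w < log_ratio u"
  using \<open>u < w\<close>
proof (rule DERIV_neg_imp_decreasing_open)
  show "continuous_on {u..w} log_ratio" using assms cusp_bounds by (auto intro!: log_cont)
  fix t assume "u < t" "t < w"
  then have t: "0 < t" "t < 2/3" "log_a_slope t < 0"
    using log_a_slope_sign[of t] assms cusp_bounds cusp_cubic_neg1[of t] by auto
  have "log_a_slope t * (5 * (2 - 9 * t) / (33 * t + 2)) < 0"
    using t \<open>u < t\<close> \<open>t < w\<close> assms cusp_bounds by (intro mult_neg_pos divide_pos_pos) auto
  then show "\<exists>y. (log_ratio has_real_derivative y) (at t) \<and> y < 0"
    using log_ratio_deriv[OF t(1,2)] by blast
qed

lemma log_ratio_branch2:
  assumes "cusp1 \<le> u" "u < w" "w \<le> 2/9"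
  shows "log_ratio u < log_ratio w"
  using \<open>u < w\<close>
proof (rule DERIV_pos_imp_increasing_open)
  show "continuous_on {u..w} log_ratio" using assms cusp_bounds by (auto intro!: log_cont)
  fix t assume "u < t" "t < w"
  then have t: "0 < t" "t < 2/3" "log_a_slope t > 0"
    using log_a_slope_sign[of t] assms cusp_bounds cusp_cubic_pos2[of t] by auto
  have "log_a_slope t * (5 * (2 - 9 * t) / (33 * t + 2)) > 0"
    using t \<open>u < t\<close> \<open>t < w\<close> assms cusp_bounds by (intro mult_pos_pos divide_pos_pos) auto
  then show "\<exists>y. (log_ratio has_real_derivative y) (at t) \<and> y > 0"
    using log_ratio_deriv[OF t(1,2)] by blast
qed

lemma log_ratio_branch3:
  assumes "2/9 \<le> u" "u < w" "w \<le> cusp3"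
  shows "log_ratio u < log_ratio w"
  using \<open>u < w\<close>
proof (rule DERIV_pos_imp_increasing_open)
  show "continuous_on {u..w} log_ratio" using assms cusp_bounds by (auto intro!: log_cont)
  fix t assume "u < t" "t < w"
  then have t: "0 < t" "t < 2/3" "log_a_slope t < 0"
    using log_a_slope_sign[of t] assms cusp_bounds cusp_cubic_neg3[of t] by auto
  have "log_a_slope t * (5 * (2 - 9 * t) / (33 * t + 2)) > 0"
    using t \<open>u < t\<close> \<open>t < w\<close> assms cusp_bounds by (intro mult_neg_neg divide_neg_pos) auto
  then show "\<exists>y. (log_ratio has_real_derivative y) (at t) \<and> y > 0"
    using log_ratio_deriv[OF t(1,2)] by blast
qed

text \<open>The middle cusp is fixed by \<open>crit_v\<close> and so lies on the diagonal. From here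
  monotonicity of the ratio places branch 2 below and branch 3 above the diagonal.\<close>

lemma log_ratio_mid: "log_ratio (2/9) = 0"
  by (simp add: log_ratio_def log_b_def crit_v_mid)

lemma log_b_less_log_a_branch2:
  assumes "cusp1 \<le> u" "u < 2/9"
  shows "log_b u < log_a u"
  using log_ratio_branch2[of u "2/9"] assms log_ratio_mid by (simp add: log_ratio_def)

lemma log_a_less_log_b_branch3:
  assumes "2/9 < u" "u \<le> cusp3"
  shows "log_a u < log_b u"
  using log_ratio_branch3[of "2/9" u] assms log_ratio_mid by (simp add: log_ratio_def)

text \<open>Reflection identifies \<open>log_a cusp3\<close> with \<open>log_b cusp1\<close>, and
  \<open>cusp1\<close> lies below the diagonal as the left end of branch 2.\<close>

lemma log_a_cusps: "log_a cusp3 < log_a cusp1"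
  using log_b_less_log_a_branch2[of cusp1] cusp_bounds by (simp add: log_b_def crit_v_cusp1)

subsection \<open>The chamber in logarithmic coordinates\<close>

text \<open>There is one parameter on each branch over \<open>A\<close>. The differences
  \<open>log_b ci - B\<close> are the values of \<open>elim_fun\<close> at its critical points
  (\<open>elim_fun_at_crit\<close>), which explains the alternating signs.\<close>

definition alternating :: "real \<Rightarrow> real \<Rightarrow> real \<Rightarrow> real \<Rightarrow> real \<Rightarrow> real \<Rightarrow> bool" where
  "alternating A B c1 c2 c3 c4 \<longleftrightarrow>
     0 < c1 \<and> c1 < cusp1 \<and> cusp1 < c2 \<and> c2 < 2/9 \<and> 2/9 < c3 \<and> c3 < cusp3 \<and> cusp3 < c4 \<and> c4 < 2/3 \<and>
     log_a c1 = A \<and> log_a c2 = A \<and> log_a c3 = A \<and> log_a c4 = A \<and>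
     B < log_b c1 \<and> log_b c2 < B \<and> B < log_b c3 \<and> log_b c4 < B"

definition log_E3 :: "(real \<times> real) set" where
  "log_E3 = {(A, B). \<exists>c1 c2 c3 c4. alternating A B c1 c2 c3 c4}"

lemma log_a_IVT:
  assumes "0 < u" "u < 2/3" "0 < w" "w < 2/3"
    and "log_a u \<le> A \<and> A \<le> log_a w"
  shows "\<exists>t. min u w \<le> t \<and> t \<le> max u w \<and> log_a t = A"
proof (cases "u \<le> w")
  case True
  have "continuous_on {u..w} log_a" using assms by (intro log_cont) auto
  from IVT'[of log_a u A w, OF _ _ True this] assms True show ?thesis by auto
next
  case False
  have "continuous_on {w..u} log_a" using assms by (intro log_cont) auto
  from IVT2'[of log_a u A w, OF _ _ _ this] assms False show ?thesis by auto
qed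

lemma crit_v_branches:
  "0 < u \<Longrightarrow> u < cusp1 \<Longrightarrow> cusp3 < crit_v u \<and> crit_v u < 2/3"
  "cusp1 < u \<Longrightarrow> u < 2/9 \<Longrightarrow> 2/9 < crit_v u \<and> crit_v u < cusp3"
  "2/9 < u \<Longrightarrow> u < cusp3 \<Longrightarrow> cusp1 < crit_v u \<and> crit_v u < 2/9"
  "cusp3 < u \<Longrightarrow> u < 2/3 \<Longrightarrow> 0 < crit_v u \<and> crit_v u < cusp1"
  using crit_v_less[of u cusp1] crit_v_less[of u "2/9"] crit_v_less[of cusp1 u]
    crit_v_less[of "2/9" u] crit_v_less[of u cusp3] crit_v_less[of cusp3 u]
    crit_v_cusp1 crit_v_cusp3 crit_v_mid crit_v_bounds[of u] cusp_bounds
  by auto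

text \<open>Reflection in the diagonal, \<open>u \<mapsto> crit_v u\<close>, exchanges the first and fourth branch of
  the discriminant, so above the diagonal the constraint from the fourth branch is implied by
  the one from the first.  The second branch lies below the diagonal anyway.\<close>
lemma log_E3_upperI:
  assumes "A \<le> B"
    and c1: "0 < c1" "c1 < cusp1" "log_a c1 = A" "B < log_b c1"
    and c3: "2/9 < c3" "c3 < cusp3" "log_a c3 = A" "B < log_b c3"
  shows "(A, B) \<in> log_E3"
proof -
  have A: "log_a cusp1 < A" "A < log_a (2/9)"
    using log_branch1(1)[of c1 cusp1] log_branch3(1)[of "2/9" c3] c1 c3 by auto
  obtain c2 where c2: "cusp1 \<le> c2" "c2 \<le> 2/9" "log_a c2 = A"
    using log_a_IVT[of cusp1 "2/9" A] A cusp_bounds by auto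
  then have "c2 \<noteq> cusp1" "c2 \<noteq> 2/9" using A by (metis less_irrefl)+
  with c2 have c2': "cusp1 < c2" "c2 < 2/9" by linarith+
  \<comment> \<open>By definition \<open>log_a (crit_v c1) = log_b c1 > B \<ge> A\<close>, so branch
    4 passes level \<open>A\<close> before \<open>crit_v c1\<close>.\<close>
  have d: "log_a (crit_v c1) > A" "cusp3 < crit_v c1" "crit_v c1 < 2/3"
    using c1 \<open>A \<le> B\<close> crit_v_branches(1)[of c1] by (auto simp: log_b_def)
  obtain c4 where c4: "cusp3 \<le> c4" "c4 \<le> crit_v c1" "log_a c4 = A"
    using log_a_IVT[of cusp3 "crit_v c1" A] A d cusp_bounds log_a_cusps by auto
  then have "c4 \<noteq> cusp3" "c4 \<noteq> crit_v c1" using A log_a_cusps d by (metis less_irrefl less_trans)+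
  with c4 have c4': "cusp3 < c4" "c4 < crit_v c1" by linarith+
  \<comment> \<open>The reflection of \<open>c4\<close> lies on branch 1 to the right of
    \<open>c1\<close>, where \<open>log_a\<close> is below \<open>A\<close>; this value is
    \<open>log_b c4\<close>.\<close>
  have "c1 < crit_v c4"
    using crit_v_less[of c4 "crit_v c1"] c4' cusp_bounds c1 crit_v_invol[of c1] by simp
  moreover have "crit_v c4 < cusp1"
    using crit_v_branches(4)[of c4] c4' d by auto
  ultimately have "log_b c4 < A"
    using log_branch1(1)[of c1 "crit_v c4"] c1 by (simp add: log_b_def)
  moreover have "log_b c2 < A"
    using log_b_less_log_a_branch2[of c2] c2' c2 by simp
  ultimately have "alternating A B c1 c2 c3 c4"
    unfolding alternating_def using c1 c2 c2' c3 c4 c4' d \<open>A \<le> B\<close> by auto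
  then show ?thesis by (auto simp: log_E3_def)
qed

section \<open>The star centre and the segments towards it\<close>

lemma log_a_at_0: "filterlim log_a at_top (at_right 0)"
  unfolding log_a_def[abs_def] crit_v_def by real_asymp

text \<open>The log-coordinate \<open>C\<close> of the star centre: the first and third branch, which bound
  the region from above, meet over \<open>C\<close>.\<close>
lemma center_exists:
  assumes "(A, A) \<in> log_E3"
  obtains C e1 e3 where "0 < e1" "e1 < cusp1" "2/9 < e3" "e3 < cusp3"
    "log_a e1 = C" "log_a e3 = C" "log_b e1 = log_b e3" "C < log_b e1"
proof -
  obtain c1 c2 c3 c4 where "alternating A A c1 c2 c3 c4"
    using assms by (auto simp: log_E3_def)
  then have c1: "0 < c1" "c1 < cusp1" "log_a c1 = A" "A < log_b c1" and
    c3: "2/9 < c3" "c3 < cusp3" "log_a c3 = A"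
    by (auto simp: alternating_def)
  have lt: "log_a cusp1 < log_a (2/9)" using log_branch2[of cusp1 "2/9"] cusp_bounds by simp
  have "eventually (\<lambda>u. log_a u > log_a (2/9)) (at_right 0)"
    using log_a_at_0 by (simp add: filterlim_at_top_dense)
  moreover have "eventually (\<lambda>u. u \<in> {0<..<cusp1}) (at_right 0)"
    using cusp_bounds by (intro eventually_at_right_real) auto
  ultimately have "eventually (\<lambda>u. log_a u > log_a (2/9) \<and> u \<in> {0<..<cusp1}) (at_right (0::real))"
    by eventually_elim auto
  then obtain d where d: "0 < d" "d < cusp1" "log_a d > log_a (2/9)"
    using eventually_happens[of _ "at_right (0::real)"] by (auto simp: trivial_limit_at_right_real)
  \<comment> \<open>On \<open>{2/9..h}\<close> branch 3 takes only values of \<open>a\<close> that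
    branch 1 also takes.\<close>
  obtain h where h: "2/9 \<le> h" "h \<le> cusp3" "log_a h = log_a cusp1"
    using log_a_IVT[of cusp3 "2/9" "log_a cusp1"] cusp_bounds log_a_cusps lt by auto
  \<comment> \<open>\<open>g\<close> inverts \<open>log_a\<close> on branch 1. Cutting off at
    \<open>d\<close> makes the interval compact, which yields continuity of the inverse.\<close>
  define g where "g = inv_into {d..cusp1} log_a"
  have inj: "inj_on log_a {d..cusp1}"
  proof (intro linorder_inj_onI)
    fix x y assume "x < y" "x \<in> {d..cusp1}" "y \<in> {d..cusp1}"
    then show "log_a x \<noteq> log_a y" using log_branch1(1)[of x y] d by auto
  qed auto
  have im: "log_a t \<in> log_a ` {d..cusp1}" if "2/9 \<le> t" "t \<le> h" for t
  proof -
    have "log_a cusp1 \<le> log_a t" "log_a t \<le> log_a (2/9)"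
      using log_branch3(1)[of t h] log_branch3(1)[of "2/9" t] that h
      by (metis le_less order.trans)+
    then obtain s where "d \<le> s" "s \<le> cusp1" "log_a s = log_a t"
      using log_a_IVT[of cusp1 d "log_a t"] d cusp_bounds by auto
    then show ?thesis by (metis atLeastAtMost_iff imageI)
  qed
  have g_cont: "continuous_on (log_a ` {d..cusp1}) g"
    unfolding g_def
    using d cusp_bounds inj by (intro continuous_on_inv log_cont) (auto simp: inv_into_f_f)
  have g_in: "d \<le> g (log_a t)" "g (log_a t) \<le> cusp1" "log_a (g (log_a t)) = log_a t"
    if "2/9 \<le> t" "t \<le> h" for t
    using inv_into_into[OF im[OF that]] f_inv_into_f[OF im[OF that]] by (auto simp: g_def)
  \<comment> \<open>\<open>f\<close> compares \<open>b/a\<close> on branches 1 and 3 over the same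
    \<open>a\<close>; a zero is an intersection of the branches.\<close>
  define f where "f t = log_ratio (g (log_a t)) - log_ratio t" for t
  have cont: "continuous_on {2/9..h} f"
  proof -
    have "continuous_on {2/9..h} log_a" using h cusp_bounds by (intro log_cont) auto
    then have "continuous_on {2/9..h} (\<lambda>t. g (log_a t))"
      using im by (intro continuous_on_compose2[OF g_cont]) auto
    moreover have "continuous_on {d..cusp1} log_ratio" using d cusp_bounds by (intro log_cont) auto
    moreover have "(\<lambda>t. g (log_a t)) ` {2/9..h} \<subseteq> {d..cusp1}"
      using g_in(1,2) by (intro image_subsetI) (simp only: atLeastAtMost_iff)
    ultimately have "continuous_on {2/9..h} (\<lambda>t. log_ratio (g (log_a t)))"
      by (intro continuous_on_compose2[of "{d..cusp1}" log_ratio "{2/9..h}" "\<lambda>t. g (log_a t)"])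
    moreover have "continuous_on {2/9..h} log_ratio" using h cusp_bounds by (intro log_cont) auto
    ultimately show ?thesis unfolding f_def by (rule continuous_on_diff)
  qed
  \<comment> \<open>Over the middle cusp, branch 1 is to the left of \<open>c1\<close>, where its
    ratio exceeds \<open>log_ratio c1 > 0\<close>.\<close>
  have "f (2/9) \<ge> 0"
  proof -
    have "log_a (g (log_a (2/9))) > A" using g_in(3)[of "2/9"] log_branch3(1)[of "2/9" c3] h c3 by simp
    then have "g (log_a (2/9)) < c1"
      using log_branch1_rev[of c1 "g (log_a (2/9))"] g_in(1,2)[of "2/9"] h c1 d by simp
    then have "log_ratio (g (log_a (2/9))) > log_ratio c1"
      using log_ratio_branch1[of "g (log_a (2/9))" c1] g_in(1)[of "2/9"] h d c1 by auto
    then show ?thesis using c1 by (simp add: f_def log_ratio_mid log_ratio_def[of c1])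
  qed
  \<comment> \<open>Over \<open>h\<close>, branch 1 has reached \<open>cusp1\<close>, below the
    diagonal, whereas branch 3 is not below it.\<close>
  moreover have "f h \<le> 0"
  proof -
    have "g (log_a h) = cusp1" unfolding g_def h(3) using inj d by (intro inv_into_f_f) auto
    moreover have "log_ratio cusp1 < 0"
      using log_b_less_log_a_branch2[of cusp1] cusp_bounds by (simp add: log_ratio_def)
    moreover have "log_ratio (2/9) \<le> log_ratio h"
      using log_ratio_branch3[of "2/9" h] h by (metis le_less)
    ultimately show ?thesis by (simp add: f_def log_ratio_mid)
  qed
  ultimately obtain e3 where e3: "2/9 \<le> e3" "e3 \<le> h" "f e3 = 0"
    using IVT2'[of f h 0 "2/9", OF _ _ _ cont] h by auto
  define e1 where "e1 = g (log_a e3)"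
  have e1: "0 < e1" "e1 \<le> cusp1" "log_a e1 = log_a e3" "log_ratio e1 = log_ratio e3"
    using g_in[of e3] e3 d by (auto simp: e1_def f_def)
  have eb: "log_b e1 = log_b e3" using e1 by (simp add: log_ratio_def)
  have "e3 \<noteq> 2/9"
  proof
    assume *: "e3 = 2/9"
    have "log_a e1 = log_a (2/9)" by (simp only: e1(3) *)
    then have "log_a e1 > A" using log_branch3(1)[of "2/9" c3] c3 by simp
    then have "e1 < c1"
      using log_branch1_rev[of c1 e1] e1 c1 by simp
    then have "log_ratio e1 > log_ratio c1" using log_ratio_branch1[of e1 c1] e1 c1 by simp
    moreover have "log_ratio e1 = 0" by (simp only: e1(4) * log_ratio_mid)
    ultimately show False using c1 by (simp add: log_ratio_def)
  qed
  then have gt: "e3 > 2/9" "log_a e3 < log_b e3" using e3 h log_a_less_log_b_branch3[of e3] by auto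
  have "e1 \<noteq> cusp1"
    using gt eb e1 log_b_less_log_a_branch2[of cusp1] cusp_bounds by auto
  moreover have "e3 \<noteq> cusp3"
    using log_a_cusps log_branch1(1)[of e1 cusp1] e1 by (cases "e1 = cusp1") auto
  ultimately show thesis
    using that[of e1 e3 "log_a e3"] e1 eb gt e3 h by auto
qed

text \<open>Moving towards the diagonal point does not increase \<open>b/a\<close>, and
  \<open>a\<close>, \<open>b\<close> stay between their end values. By \<open>log_E3_upperI\<close>
  the moved point need only remain below branches 1 and 3; which monotone quantity shows this
  depends on whether \<open>a\<close> and \<open>b\<close> exceed \<open>c\<close>.\<close>

lemma log_E3_star_upper:
  fixes a b c t :: real
  assumes center: "0 < e1" "e1 < cusp1" "2/9 < e3" "e3 < cusp3"
      "log_a e1 = 35 * ln c" "log_a e3 = 35 * ln c" "log_b e1 = log_b e3" "35 * ln c < log_b e1"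
    and pos: "0 < a" "0 < b" "0 < c" and le: "a \<le> b" and t: "0 \<le> t" "t \<le> 1"
    and ab: "(35 * ln a, 35 * ln b) \<in> log_E3"
  shows "(35 * ln ((1 - t) * c + t * a), 35 * ln ((1 - t) * c + t * b)) \<in> log_E3"
proof -
  define a' where "a' = (1 - t) * c + t * a"
  define b' where "b' = (1 - t) * c + t * b"
  define A where "A = 35 * ln a"
  define B where "B = 35 * ln b"
  define C where "C = 35 * ln c"
  define A' where "A' = 35 * ln a'"
  define B' where "B' = 35 * ln b'"
  have mem: "min c z \<le> (1 - t) * c + t * z" "(1 - t) * c + t * z \<le> max c z" for z
  proof -
    have "(1 - t) * min c z + t * min c z \<le> (1 - t) * c + t * z"
      using t by (intro add_mono mult_left_mono) auto
    then show "min c z \<le> (1 - t) * c + t * z" by (simp add: algebra_simps)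
    have "(1 - t) * c + t * z \<le> (1 - t) * max c z + t * max c z"
      using t by (intro add_mono mult_left_mono) auto
    then show "(1 - t) * c + t * z \<le> max c z" by (simp add: algebra_simps)
  qed
  have pos': "0 < a'" "0 < b'" using mem(1)[of a] mem(1)[of b] pos by (auto simp: a'_def b'_def)
  have le': "a' \<le> b'" using le t by (auto simp: a'_def b'_def intro: mult_left_mono)
  have "A' \<le> B'" using le' pos' by (simp add: A'_def B'_def)
  have between_A: "A \<le> C \<Longrightarrow> A \<le> A' \<and> A' \<le> C" "C \<le> A \<Longrightarrow> C \<le> A' \<and> A' \<le> A"
    using mem[of a] pos pos' by (auto simp: A_def A'_def C_def a'_def[symmetric])
  have between_B: "B \<le> C \<Longrightarrow> B \<le> B' \<and> B' \<le> C" "C \<le> B \<Longrightarrow> C \<le> B' \<and> B' \<le> B"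
    using mem[of b] pos pos' by (auto simp: B_def B'_def C_def b'_def[symmetric])
  have ratio: "B' - A' \<le> B - A"
  proof -
    have "(1 - t) * c * a \<le> (1 - t) * c * b" using le pos t by (intro mult_left_mono) auto
    then have "b' * a \<le> b * a'" by (simp add: a'_def b'_def algebra_simps)
    then have "ln (b' * a) \<le> ln (b * a')" using pos pos' by simp
    then show ?thesis using pos pos' by (simp add: ln_mult A_def B_def A'_def B'_def)
  qed
  note center = center[folded C_def]
  obtain c1 c2 c3 c4 where "alternating A B c1 c2 c3 c4"
    using ab by (auto simp: log_E3_def A_def B_def)
  then have c1: "0 < c1" "c1 < cusp1" "log_a c1 = A" "B < log_b c1" and
    c3: "2/9 < c3" "c3 < cusp3" "log_a c3 = A" "B < log_b c3"
    by (auto simp: alternating_def)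
  have "\<exists>d1. min c1 e1 \<le> d1 \<and> d1 \<le> max c1 e1 \<and> log_a d1 = A'"
    using log_a_IVT[of c1 e1 A'] log_a_IVT[of e1 c1 A'] between_A c1 center cusp_bounds
    by (cases "A \<le> C") (auto simp: min.commute max.commute)
  then obtain d1 where d1: "min c1 e1 \<le> d1" "d1 \<le> max c1 e1" "log_a d1 = A'" by blast
  have d1': "0 < d1" "d1 < cusp1" using d1 c1 center by auto
  have "\<exists>d3. min c3 e3 \<le> d3 \<and> d3 \<le> max c3 e3 \<and> log_a d3 = A'"
    using log_a_IVT[of c3 e3 A'] log_a_IVT[of e3 c3 A'] between_A c3 center cusp_bounds
    by (cases "A \<le> C") (auto simp: min.commute max.commute)
  then obtain d3 where d3: "min c3 e3 \<le> d3" "d3 \<le> max c3 e3" "log_a d3 = A'" by blast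
  have d3': "2/9 < d3" "d3 < cusp3" using d3 c3 center by auto
  have br1: "w \<le> u" if "0 < u" "u < cusp1" "0 < w" "w < cusp1" "log_a u \<le> log_a w" for u w
    using log_branch1(1)[of u w] that by fastforce
  have br3: "w \<le> u" if "2/9 < u" "u < cusp3" "2/9 < w" "w < cusp3" "log_a u \<le> log_a w" for u w
    using log_branch3(1)[of u w] that by fastforce
  have ra1: "log_ratio u \<le> log_ratio w" if "0 < w" "w \<le> u" "u \<le> cusp1" for u w
    using log_ratio_branch1[of w u] that by (cases "w = u") auto
  have ra3: "log_ratio w \<le> log_ratio u" if "2/9 < w" "w \<le> u" "u \<le> cusp3" for u w
    using log_ratio_branch3[of w u] that by (cases "w = u") auto
  have "B' < log_b d1 \<and> B' < log_b d3"
  proof (cases "C \<le> A")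
    case True
    \<comment> \<open>For \<open>a \<ge> c\<close> the ratio bound keeps the point below branch 3,
      and to the right of the crossing branch 1 is at least as high as branch 3.\<close>
    have "log_ratio c3 \<le> log_ratio d3"
      using br3[of d3 c3] ra3[of c3 d3] between_A(2)[OF True] c3 d3 d3' by auto
    then have "B' < log_b d3"
      using ratio c3 d3 by (simp add: log_ratio_def)
    moreover have "log_ratio e1 \<le> log_ratio d1"
      using br1[of e1 d1] ra1[of d1 e1] between_A(2)[OF True] center d1 d1' by auto
    moreover have "log_ratio d3 \<le> log_ratio e3"
      using br3[of e3 d3] ra3[of d3 e3] between_A(2)[OF True] center d3 d3' by auto
    ultimately show ?thesis
      using center d1 d3 by (simp add: log_ratio_def)
  next
    case False
    then have AC: "A \<le> A'" "A' \<le> C" using between_A by auto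
    \<comment> \<open>For \<open>a < c\<close> the ratio bound works on branch 1. Branch 3 is
      compared through \<open>b\<close> if \<open>b \<ge> c\<close>.\<close>
    have "log_ratio c1 \<le> log_ratio d1"
      using br1[of c1 d1] ra1[of d1 c1] AC c1 d1 d1' by auto
    then have B1: "B' < log_b d1" using ratio c1 d1 by (simp add: log_ratio_def)
    have "B' < log_b d3"
    proof (cases "C \<le> B")
      case True
      have "d3 \<le> c3" using br3[of c3 d3] AC c3 d3 d3' by auto
      then have "log_b c3 \<le> log_b d3"
        using log_branch3(2)[of d3 c3] c3 d3' by (cases "d3 = c3") auto
      then show ?thesis using between_B(2)[OF True] c3 by simp
    next
      case False
      then have "B' \<le> C" using between_B by auto
      show ?thesis
      \<comment> \<open>If \<open>b < c\<close> and branch 3 failed, branch 1 would have a point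
        \<open>d\<close> at the height of \<open>d3\<close> with smaller \<open>a\<close>, hence
        larger ratio. But \<open>d\<close> and \<open>d3\<close> lie beyond the crossing, where
        ratios on branch 1 are at most, and on branch 3 at least, that of the crossing.\<close>
      proof (rule ccontr)
        assume "\<not> B' < log_b d3"
        then have h: "log_b d3 \<le> B'" by simp
        have "log_b cusp3 < log_b d3" using log_branch3(2)[of d3 cusp3] d3' by simp
        moreover have "log_b cusp1 < log_b cusp3"
          using log_a_cusps by (simp add: log_b_def crit_v_cusp1 crit_v_cusp3)
        moreover have "continuous_on {d1..cusp1} log_b"
          using d1' cusp_bounds by (intro log_cont) auto
        ultimately obtain d where d: "d1 \<le> d" "d \<le> cusp1" "log_b d = log_b d3"
          using IVT2'[of log_b cusp1 "log_b d3" d1] h B1 d1' by auto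
        have "d1 \<noteq> d" using d h B1 by auto
        then have "log_a d < A'" using log_branch1(1)[of d1 d] d d1 d1' by auto
        have "e1 \<le> d"
          using log_branch1(2)[of d e1] d d1' center h \<open>B' \<le> C\<close> by (cases "e1 \<le> d") auto
        then have "log_ratio d \<le> log_ratio e1" using ra1[of e1 d] center d by auto
        moreover have "e3 \<le> d3" using br3[of d3 e3] AC center d3 d3' by auto
        then have "log_ratio e3 \<le> log_ratio d3" using ra3[of e3 d3] center d3' by auto
        ultimately show False
          using \<open>log_a d < A'\<close> d d3 center by (simp add: log_ratio_def)
      qed
    qed
    with B1 show ?thesis by simp
  qed
  then have "(A', B') \<in> log_E3"
    using log_E3_upperI[OF \<open>A' \<le> B'\<close>] d1 d1' d3 d3' by blast
  then show ?thesis by (simp add: A'_def B'_def a'_def b'_def)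
qed

text \<open>On the diagonal \<open>log_E3_upperI\<close> applies with \<open>B = A\<close>. Branch 3
  is above the diagonal anyway, so the work is to locate \<open>A\<close> and to control branch
  1.\<close>

lemma log_E3_44_31: "(35 * ln (44/31), 35 * ln (44/31)) \<in> log_E3"
proof -
  define A :: real where "A = 35 * ln (44/31)"
  \<comment> \<open>A rational point of branch 1, as \<open>3/40 < 1/11 < cusp1\<close>, that is
    already above the diagonal and has \<open>log_a d \<le> A\<close>. Exponentiating turns each
    claim into a comparison of rational powers.\<close>
  define d :: real where "d = 3/40"
  have v: "crit_v d = 142/321" by (simp add: crit_v_def d_def)
  have "log_a d \<le> A"
  proof -
    have "(37/40::real) ^ 35 \<le> (44/31) ^ 35 * (3/40)^2 * (142/321)^12"
      by (simp add: power_divide)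
    then have "ln ((37/40::real) ^ 35) \<le> ln ((44/31) ^ 35 * (3/40)^2 * (142/321)^12)"
      by (subst ln_le_cancel_iff) auto
    then show ?thesis
      unfolding log_a_def v by (simp add: A_def d_def ln_mult ln_realpow)
  qed
  have "log_a d < log_b d"
  proof -
    have "(37/40::real) ^ 35 * (3/40)^10 < (179/321) ^ 35 * (142/321)^10"
      by (simp add: power_divide)
    then have "ln ((37/40::real) ^ 35 * (3/40)^10) < ln ((179/321) ^ 35 * (142/321)^10)"
      by (subst ln_less_cancel_iff) auto
    then have "35 * ln (37/40::real) + 10 * ln (3/40) < 35 * ln (179/321) + 10 * ln (142/321)"
      by (simp add: ln_mult ln_realpow)
    moreover have "log_b d = 35 * ln (1 - crit_v d) - 2 * ln (crit_v d) - 12 * ln d"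
      by (rule log_b_eq) (auto simp: d_def)
    ultimately show ?thesis
      unfolding log_a_def v by (simp add: d_def)
  qed
  have "A < log_a (2/9)"
  proof -
    have "(44/31::real) ^ 35 * (2/9) ^ 14 < (7/9) ^ 35"
      by (simp add: power_divide)
    then have "ln ((44/31::real) ^ 35 * (2/9) ^ 14) < ln ((7/9) ^ 35)"
      by (subst ln_less_cancel_iff) auto
    then show ?thesis
      unfolding log_a_def crit_v_mid by (simp add: A_def ln_mult ln_realpow)
  qed
  have "d < cusp1" using cusp_bounds by (simp add: d_def)
  then have cA: "log_a cusp1 < A"
    using log_branch1(1)[of d cusp1] \<open>log_a d \<le> A\<close> by (simp add: d_def)
  have "eventually (\<lambda>u. log_a u > A) (at_right 0)"
    using log_a_at_0 by (simp add: filterlim_at_top_dense)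
  moreover have "eventually (\<lambda>u. u \<in> {0<..<d}) (at_right 0)"
    by (intro eventually_at_right_real) (auto simp: d_def)
  ultimately have "eventually (\<lambda>u. log_a u > A \<and> u \<in> {0<..<d}) (at_right (0::real))"
    by eventually_elim auto
  then obtain e where e: "0 < e" "e < d" "log_a e > A"
    using eventually_happens[of _ "at_right (0::real)"] by (auto simp: trivial_limit_at_right_real)
  then obtain c1 where c1: "e \<le> c1" "c1 \<le> d" "log_a c1 = A"
    using log_a_IVT[of d e A] \<open>log_a d \<le> A\<close> \<open>d < cusp1\<close> cusp_bounds by auto
  \<comment> \<open>The ratio grows to the left on branch 1 and is positive at \<open>d\<close>, so
    \<open>c1\<close> is above the diagonal as well.\<close>
  have "log_ratio d \<le> log_ratio c1"
    using log_ratio_branch1[of c1 d] c1 e \<open>d < cusp1\<close> by (cases "c1 = d") auto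
  then have "A < log_b c1" using \<open>log_a d < log_b d\<close> c1 by (simp add: log_ratio_def)
  obtain c3 where c3: "2/9 \<le> c3" "c3 \<le> cusp3" "log_a c3 = A"
    using log_a_IVT[of cusp3 "2/9" A] \<open>A < log_a (2/9)\<close> cA log_a_cusps cusp_bounds by auto
  have "c3 \<noteq> 2/9" "c3 \<noteq> cusp3"
    using c3(3) \<open>A < log_a (2/9)\<close> cA log_a_cusps by (metis less_irrefl less_trans)+
  then have "A < log_b c3" using log_a_less_log_b_branch3[of c3] c3 by auto
  show ?thesis
    unfolding A_def[symmetric]
  proof (rule log_E3_upperI)
    show "0 < c1" "c1 < cusp1" using c1 e \<open>d < cusp1\<close> by linarith+
    show "2/9 < c3" "c3 < cusp3" using c3 \<open>c3 \<noteq> 2/9\<close> \<open>c3 \<noteq> cusp3\<close> by linarith+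
  qed (fact order.refl c1 c3 \<open>A < log_b c1\<close> \<open>A < log_b c3\<close>)+
qed

subsection \<open>Zeros of the eliminated equation\<close>

text \<open>Here \<open>A = 35 ln a\<close> and \<open>B = 35 ln b\<close>: \<open>elim_v A u\<close> is \<open>v\<close> as given by the first equation, and
  \<open>elim_fun A B u = 0\<close> is the second equation after this substitution.\<close>
definition elim_v :: "real \<Rightarrow> real \<Rightarrow> real" where
  "elim_v A u = exp ((35 * ln (1 - u) - 2 * ln u - A) / 12)"

definition elim_fun :: "real \<Rightarrow> real \<Rightarrow> real \<Rightarrow> real" where
  "elim_fun A B u = 35 * ln (1 - elim_v A u) - 2 * ln (elim_v A u) - 12 * ln u - B"

text \<open>The range in which all logarithms in \<open>elim_fun\<close> have positive arguments.
  For \<open>a, b > 0\<close> every positive root lands here, because \<open>1 - u = a y^2\<close>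
  and \<open>1 - v = b x^2\<close>.\<close>

definition elim_dom :: "real \<Rightarrow> real set" where
  "elim_dom A = {u. 0 < u \<and> u < 1 \<and> elim_v A u < 1}"

lemma elim_v_pos [simp]: "0 < elim_v A u"
  by (simp add: elim_v_def)

lemma ln_elim_v: "ln (elim_v A u) = (35 * ln (1 - u) - 2 * ln u - A) / 12"
  by (simp add: elim_v_def)

lemma elim_v_less:
  assumes "0 < u" "u < w" "w < 1"
  shows "elim_v A w < elim_v A u"
proof -
  have "ln (1 - w) < ln (1 - u)" "ln u < ln w" using assms by auto
  then show ?thesis by (simp add: elim_v_def)
qed

text \<open>Since \<open>elim_v\<close> decreases, the domain is an interval reaching up to
  1.\<close>

lemma elim_dom_up: "u \<in> elim_dom A \<Longrightarrow> u \<le> w \<Longrightarrow> w < 1 \<Longrightarrow> w \<in> elim_dom A"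
  using elim_v_less[of u w A] by (cases "u = w") (auto simp: elim_dom_def)

lemma elim_v_deriv:
  assumes "0 < u" "u < 1"
  shows "(elim_v A has_real_derivative
           - elim_v A u * (33 * u + 2) / (12 * u * (1 - u))) (at u)"
proof -
  have "((\<lambda>u. (35 * ln (1 - u) - 2 * ln u - A) / 12) has_real_derivative
          (- 35 / (1 - u) - 2 / u) / 12) (at u)"
    using assms by (auto intro!: derivative_eq_intros)
  from DERIV_fun_exp[OF this]
  have "(elim_v A has_real_derivative elim_v A u * ((- 35 / (1 - u) - 2 / u) / 12)) (at u)"
    by (simp add: elim_v_def[abs_def])
  moreover have "elim_v A u * ((- 35 / (1 - u) - 2 / u) / 12)
      = - elim_v A u * (33 * u + 2) / (12 * u * (1 - u))"
  proof -
    have "(- 35 / (1 - u) - 2 / u) / 12 = - (33 * u + 2) / (12 * u * (1 - u))"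
      using assms by (simp add: divide_simps)
    then show ?thesis by (simp only: times_divide_eq_right mult_minus_left mult_minus_right)
  qed
  ultimately show ?thesis by (simp only:)
qed

lemma elim_v_cont: "S \<subseteq> {0<..<1} \<Longrightarrow> continuous_on S (elim_v A)"
  by (intro continuous_at_imp_continuous_on ballI DERIV_isCont[OF elim_v_deriv]) auto

text \<open>With \<open>w = elim_v A u\<close> the numerator
  \<open>(33u + 2)(33w + 2) - 144(1 - u)(1 - w)\<close> is 35 times the discriminant polynomial. So
  the critical points are exactly those where \<open>(u, w)\<close> lies on the
  discriminant.\<close>

lemma elim_fun_deriv:
  assumes "u \<in> elim_dom A"
  shows "(elim_fun A B has_real_derivative
      35 * ((27 * u + 6) * (elim_v A u - crit_v u)) / (12 * u * (1 - u) * (1 - elim_v A u))) (at u)"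
proof -
  define w where "w = elim_v A u"
  have u: "0 < u" "u < 1" and w: "0 < w" "w < 1" using assms by (auto simp: elim_dom_def w_def)
  have "(elim_fun A B has_real_derivative
      (w * (33 * u + 2) / (12 * u * (1 - u))) * (35 / (1 - w) + 2 / w) - 12 / u) (at u)"
  proof -
    define D where "D = - (w * (33 * u + 2) / (12 * u * (1 - u)))"
    have "(elim_v A has_real_derivative D) (at u)"
      using elim_v_deriv[OF u, of A] by (simp add: D_def w_def)
    then have "(elim_fun A B has_real_derivative 35 * (- D / (1 - w)) - 2 * (D / w) - 12 / u) (at u)"
      unfolding elim_fun_def[abs_def]
      using u w by (auto intro!: derivative_eq_intros simp: w_def mult.commute)
    moreover have "35 * (- D / (1 - w)) - 2 * (D / w) - 12 / u
        = (w * (33 * u + 2) / (12 * u * (1 - u))) * (35 / (1 - w) + 2 / w) - 12 / u"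
      unfolding D_def by (simp add: ring_distribs)
    ultimately show ?thesis by (simp only:)
  qed
  moreover have "(w * (33 * u + 2) / (12 * u * (1 - u))) * (35 / (1 - w) + 2 / w) - 12 / u
      = 35 * (27 * u * w + 6 * (u + w) - 4) / (12 * u * (1 - u) * (1 - w))"
  proof -
    have "35 / (1 - w) + 2 / w = (33 * w + 2) / (w * (1 - w))"
      using w by (simp add: field_simps)
    then have "(w * (33 * u + 2) / (12 * u * (1 - u))) * (35 / (1 - w) + 2 / w)
        = (33 * u + 2) * (33 * w + 2) / (12 * u * (1 - u) * (1 - w))"
      using u w by simp
    moreover have "12 / u = 144 * (1 - u) * (1 - w) / (12 * u * (1 - u) * (1 - w))"
      using u w by (simp add: divide_simps)
    ultimately have "(w * (33 * u + 2) / (12 * u * (1 - u))) * (35 / (1 - w) + 2 / w) - 12 / u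
        = ((33 * u + 2) * (33 * w + 2) - 144 * (1 - u) * (1 - w)) / (12 * u * (1 - u) * (1 - w))"
      by (simp only: diff_divide_distrib)
    also have "(33 * u + 2) * (33 * w + 2) - 144 * (1 - u) * (1 - w)
        = 35 * (27 * u * w + 6 * (u + w) - 4)"
      by (simp add: algebra_simps)
    finally show ?thesis .
  qed
  moreover have "27 * u * w + 6 * (u + w) - 4 = (27 * u + 6) * (w - crit_v u)"
    using u by (simp add: crit_v_def field_simps)
  ultimately show ?thesis unfolding w_def[symmetric] by (simp only:)
qed

text \<open>The identity \<open>12 (ln (elim_v A u) - ln (crit_v u)) = log_a u - A\<close> turns the
  sign of the derivative of \<open>elim_fun\<close> into the position of \<open>log_a u\<close>
  relative to \<open>A\<close>.\<close>

lemma elim_v_crit_v: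
  assumes "0 < u" "u < 2/3"
  shows "crit_v u < elim_v A u \<longleftrightarrow> A < log_a u" "elim_v A u < crit_v u \<longleftrightarrow> log_a u < A"
    "elim_v A u = crit_v u \<longleftrightarrow> log_a u = A"
proof -
  have v: "0 < crit_v u" using crit_v_bounds assms by auto
  have *: "12 * (ln (elim_v A u) - ln (crit_v u)) = log_a u - A"
    by (simp add: ln_elim_v log_a_def)
  have "crit_v u < elim_v A u \<longleftrightarrow> ln (crit_v u) < ln (elim_v A u)"
    "elim_v A u < crit_v u \<longleftrightarrow> ln (elim_v A u) < ln (crit_v u)"
    "elim_v A u = crit_v u \<longleftrightarrow> ln (elim_v A u) = ln (crit_v u)"
    using v by auto
  then show "crit_v u < elim_v A u \<longleftrightarrow> A < log_a u" "elim_v A u < crit_v u \<longleftrightarrow> log_a u < A"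
    "elim_v A u = crit_v u \<longleftrightarrow> log_a u = A"
    using * by auto
qed

lemma elim_v_gt_crit_v: "2/3 \<le> u \<Longrightarrow> crit_v u < elim_v A u"
proof -
  assume "2/3 \<le> u"
  then have "crit_v u \<le> 0" by (simp add: crit_v_def divide_nonpos_pos)
  then show ?thesis using elim_v_pos[of A u] by linarith
qed

lemma elim_fun_at_crit:
  assumes "0 < u" "u < 2/3" "log_a u = A"
  shows "elim_fun A B u = log_b u - B" "u \<in> elim_dom A"
proof -
  have "elim_v A u = crit_v u" using elim_v_crit_v(3)[of u A] assms by simp
  then show "elim_fun A B u = log_b u - B" "u \<in> elim_dom A"
    using assms crit_v_bounds[of u] by (auto simp: elim_fun_def log_b_eq elim_dom_def)
qed

lemma elim_fun_cont: "S \<subseteq> elim_dom A \<Longrightarrow> continuous_on S (elim_fun A B)"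
  by (intro continuous_at_imp_continuous_on ballI DERIV_isCont[OF elim_fun_deriv]) auto

text \<open>From \<open>2/3\<close> on, \<open>crit_v\<close> is nonpositive and the derivative is
  automatically positive, so \<open>log_a\<close> is constrained only before
  \<open>2/3\<close>.\<close>

lemma elim_fun_increasing:
  assumes "u \<in> elim_dom A" "u < w" "w < 1"
    and gt: "\<And>t. u < t \<Longrightarrow> t < w \<Longrightarrow> t < 2/3 \<Longrightarrow> A < log_a t"
  shows "elim_fun A B u < elim_fun A B w"
  using \<open>u < w\<close>
proof (rule DERIV_pos_imp_increasing_open)
  show "continuous_on {u..w} (elim_fun A B)"
    using assms elim_dom_up[of u A] by (intro elim_fun_cont) auto
  fix t assume t: "u < t" "t < w"
  then have dom: "t \<in> elim_dom A" using assms elim_dom_up[of u A t] by auto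
  then have "0 < t" "t < 1" "elim_v A t < 1" by (auto simp: elim_dom_def)
  moreover have "elim_v A t > crit_v t"
    using gt[OF t] elim_v_gt_crit_v[of t A] elim_v_crit_v(1)[of t A] \<open>0 < t\<close>
    by (cases "t < 2/3") auto
  ultimately have "35 * ((27 * t + 6) * (elim_v A t - crit_v t)) / (12 * t * (1 - t) * (1 - elim_v A t)) > 0"
    by (intro divide_pos_pos mult_pos_pos) auto
  then show "\<exists>y. (elim_fun A B has_real_derivative y) (at t) \<and> y > 0"
    using elim_fun_deriv[OF dom] by blast
qed

lemma elim_fun_decreasing:
  assumes "u \<in> elim_dom A" "u < w" "w < 2/3"
    and lt: "\<And>t. u < t \<Longrightarrow> t < w \<Longrightarrow> log_a t < A"
  shows "elim_fun A B w < elim_fun A B u"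
  using \<open>u < w\<close>
proof (rule DERIV_neg_imp_decreasing_open)
  show "continuous_on {u..w} (elim_fun A B)"
    using assms elim_dom_up[of u A] by (intro elim_fun_cont) auto
  fix t assume t: "u < t" "t < w"
  then have dom: "t \<in> elim_dom A" using assms elim_dom_up[of u A t] by auto
  then have "0 < t" "t < 1" "elim_v A t < 1" by (auto simp: elim_dom_def)
  moreover have "elim_v A t < crit_v t"
    using lt[OF t] elim_v_crit_v(2)[of t A] \<open>0 < t\<close> t assms by auto
  ultimately have "35 * ((27 * t + 6) * (elim_v A t - crit_v t)) / (12 * t * (1 - t) * (1 - elim_v A t)) < 0"
    by (intro divide_neg_pos mult_pos_neg mult_pos_pos) auto
  then show "\<exists>y. (elim_fun A B has_real_derivative y) (at t) \<and> y < 0"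
    using elim_fun_deriv[OF dom] by blast
qed

lemma elim_fun_Rolle:
  assumes "r \<in> elim_dom A" "r < s" "s < 1" "elim_fun A B r = elim_fun A B s"
  obtains c where "r < c" "c < s" "c < 2/3" "log_a c = A"
proof -
  have dom: "t \<in> elim_dom A" if "r \<le> t" "t \<le> s" for t
    using that assms elim_dom_up[of r A t] by auto
  have "continuous_on {r..s} (elim_fun A B)" using dom by (intro elim_fun_cont) auto
  then obtain c where c: "r < c" "c < s" "(elim_fun A B has_real_derivative 0) (at c)"
    using Rolle[of r s "elim_fun A B"] assms elim_fun_deriv[OF dom]
    by (metis real_differentiable_def less_imp_le)
  have dc: "c \<in> elim_dom A" using dom c by auto
  then have "0 < c" "c < 1" "elim_v A c < 1" by (auto simp: elim_dom_def)
  moreover have "35 * ((27 * c + 6) * (elim_v A c - crit_v c)) / (12 * c * (1 - c) * (1 - elim_v A c)) = 0"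
    using DERIV_unique[OF elim_fun_deriv[OF dc] c(3)] .
  ultimately have eq: "elim_v A c = crit_v c" by auto
  then have "c < 2/3" using elim_v_gt_crit_v[of c A] by (cases "c < 2/3") auto
  with eq show thesis using that[of c] c elim_v_crit_v(3)[of c A] \<open>0 < c\<close> by auto
qed

section \<open>Five zeros of the eliminated equation and the alternating condition\<close>

lemma log_a_sign:
  assumes "0 < c1" "c1 < cusp1" "cusp1 < c2" "c2 < 2/9" "2/9 < c3" "c3 < cusp3" "cusp3 < c4" "c4 < 2/3"
    and "log_a c1 = A" "log_a c2 = A" "log_a c3 = A" "log_a c4 = A"
    and t: "0 < t" "t < 2/3"
  shows "t < c1 \<Longrightarrow> A < log_a t" "c1 < t \<Longrightarrow> t < c2 \<Longrightarrow> log_a t < A"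
    "c2 < t \<Longrightarrow> t < c3 \<Longrightarrow> A < log_a t" "c3 < t \<Longrightarrow> t < c4 \<Longrightarrow> log_a t < A"
    "c4 < t \<Longrightarrow> A < log_a t"
proof -
  show "t < c1 \<Longrightarrow> A < log_a t"
    using log_branch1(1)[of t c1] assms by simp
  show "c1 < t \<Longrightarrow> t < c2 \<Longrightarrow> log_a t < A"
    using log_branch1(1)[of c1 t] log_branch2(1)[of t c2] assms by (cases "t \<le> cusp1") simp_all
  show "c2 < t \<Longrightarrow> t < c3 \<Longrightarrow> A < log_a t"
    using log_branch2(1)[of c2 t] log_branch3(1)[of t c3] assms by (cases "t \<le> 2/9") simp_all
  show "c3 < t \<Longrightarrow> t < c4 \<Longrightarrow> log_a t < A"
    using log_branch3(1)[of c3 t] log_branch4(1)[of t c4] assms by (cases "t \<le> cusp3") simp_all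
  show "c4 < t \<Longrightarrow> A < log_a t"
    using log_branch4(1)[of c4 t] assms by simp
qed

text \<open>Rolle gives four parameters over \<open>A\<close> between consecutive zeros. Strict
  monotonicity from each zero to a neighbouring critical point fixes the sign there.\<close>

lemma five_zeros_imp_log_E3:
  assumes r: "r1 < r2" "r2 < r3" "r3 < r4" "r4 < r5"
    and dom: "\<And>r. r \<in> {r1, r2, r3, r4, r5} \<Longrightarrow> r \<in> elim_dom A"
    and zero: "\<And>r. r \<in> {r1, r2, r3, r4, r5} \<Longrightarrow> elim_fun A B r = 0"
  shows "(A, B) \<in> log_E3"
proof -
  have r01: "0 < r1" "r2 < 1" "r3 < 1" "r4 < 1" "r5 < 1" using dom by (auto simp: elim_dom_def)
  obtain c1 where c1: "r1 < c1" "c1 < r2" "c1 < 2/3" "log_a c1 = A"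
    using elim_fun_Rolle[of r1 A r2 B] r dom zero r01 by auto
  obtain c2 where c2: "r2 < c2" "c2 < r3" "c2 < 2/3" "log_a c2 = A"
    using elim_fun_Rolle[of r2 A r3 B] r dom zero r01 by auto
  obtain c3 where c3: "r3 < c3" "c3 < r4" "c3 < 2/3" "log_a c3 = A"
    using elim_fun_Rolle[of r3 A r4 B] r dom zero r01 by auto
  obtain c4 where c4: "r4 < c4" "c4 < r5" "c4 < 2/3" "log_a c4 = A"
    using elim_fun_Rolle[of r4 A r5 B] r dom zero r01 by auto
  note c = c1 c2 c3 c4
  \<comment> \<open>No branch holds two of the \<open>ci\<close>, since \<open>log_a\<close> is
    injective on it. Working from the left gives the lower bounds, working from the right the upper
    bounds.\<close>
  have lo: "cusp1 < c2" "2/9 < c3" "cusp3 < c4"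
  proof -
    show "cusp1 < c2"
      using log_branch1(1)[of c1 c2] c r01 by (cases "cusp1 < c2") auto
    then show "2/9 < c3"
      using log_branch2(1)[of c2 c3] c r01 by (cases "2/9 < c3") auto
    then show "cusp3 < c4"
      using log_branch3(1)[of c3 c4] c r01 by (cases "cusp3 < c4") auto
  qed
  have hi: "c3 < cusp3" "c2 < 2/9" "c1 < cusp1"
  proof -
    show "c3 < cusp3"
      using log_branch4(1)[of c3 c4] c r01 by (cases "c3 < cusp3") auto
    then show "c2 < 2/9"
      using log_branch3(1)[of c2 c3] c r01 by (cases "c2 < 2/9") auto
    then show "c1 < cusp1"
      using log_branch2(1)[of c1 c2] c r01 by (cases "c1 < cusp1") auto
  qed
  have "0 < c1" using c r01 by simp
  note sign = log_a_sign[OF this hi(3) lo(1) hi(2) lo(2) hi(1) lo(3) c4(3) c1(4) c2(4) c3(4) c4(4)]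
  have "elim_fun A B r1 < elim_fun A B c1"
    using dom c r01 sign(1) by (intro elim_fun_increasing) auto
  moreover have "elim_fun A B c2 < elim_fun A B r2"
    using dom c r r01 sign(2) by (intro elim_fun_decreasing) auto
  moreover have "elim_fun A B r3 < elim_fun A B c3"
    using dom c r r01 sign(3) by (intro elim_fun_increasing) auto
  moreover have "elim_fun A B c4 < elim_fun A B r4"
    using dom c r r01 sign(4) by (intro elim_fun_decreasing) auto
  moreover have "elim_fun A B c1 = log_b c1 - B" "elim_fun A B c2 = log_b c2 - B"
    "elim_fun A B c3 = log_b c3 - B" "elim_fun A B c4 = log_b c4 - B"
    using c r r01 by (auto intro!: elim_fun_at_crit)
  ultimately have "alternating A B c1 c2 c3 c4"
    unfolding alternating_def using \<open>0 < c1\<close> hi lo c zero[of r1] zero[of r2] zero[of r3] zero[of r4] by auto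
  then show ?thesis by (auto simp: log_E3_def)
qed

text \<open>Towards the left end of the domain \<open>elim_v\<close> tends to 1, so
  \<open>35 ln (1 - elim_v)\<close> tends to minus infinity.\<close>

lemma elim_fun_neg_left:
  assumes c: "c \<in> elim_dom A"
  shows "\<exists>u\<in>elim_dom A. u < c \<and> elim_fun A B u < 0"
proof -
  have c01: "0 < c" "c < 1" "elim_v A c < 1" using c by (auto simp: elim_dom_def)
  have "filterlim (\<lambda>u. 35 * ln (1 - u) - 2 * ln u - A) at_top (at_right 0)" by real_asymp
  then have "eventually (\<lambda>u. 35 * ln (1 - u) - 2 * ln u - A > 0) (at_right 0)"
    unfolding filterlim_at_top_dense by blast
  moreover have "eventually (\<lambda>u. u \<in> {0<..<c}) (at_right 0)"
    using c01 by (intro eventually_at_right_real) auto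
  ultimately have "eventually (\<lambda>u. 35 * ln (1 - u) - 2 * ln u - A > 0 \<and> u \<in> {0<..<c}) (at_right (0::real))"
    by eventually_elim auto
  then obtain d where d: "0 < d" "d < c" "35 * ln (1 - d) - 2 * ln d - A > 0"
    using eventually_happens[of _ "at_right (0::real)"] by (auto simp: trivial_limit_at_right_real)
  then have "elim_v A d > 1" by (simp add: elim_v_def)
  \<comment> \<open>\<open>M\<close> bounds the remaining terms for \<open>u \<ge> d\<close>. The
    value \<open>m\<close> of \<open>elim_v\<close> is so close to 1 that
    \<open>35 ln (1 - m) \<le> M - 1\<close>, which makes \<open>elim_fun\<close> negative.\<close>
  define M where "M = B + 2 * ln (elim_v A c) + 12 * ln d"
  define m where "m = max ((1 + elim_v A c) / 2) (1 - exp ((M - 1) / 35))"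
  have m: "elim_v A c < m" "m < 1" using c01 by (auto simp: m_def less_max_iff_disj)
  have "continuous_on {d..c} (elim_v A)" using d c01 by (intro elim_v_cont) auto
  then obtain u where u: "d \<le> u" "u \<le> c" "elim_v A u = m"
    using IVT2'[of "elim_v A" c m d] m d \<open>elim_v A d > 1\<close> by auto
  have "u \<noteq> c" using u m by auto
  have "ln (1 - m) \<le> ln (exp ((M - 1) / 35))"
    using m by (subst ln_le_cancel_iff) (auto simp: m_def)
  then have "35 * ln (1 - m) \<le> M - 1" by simp
  moreover have "ln (elim_v A c) < ln m" using m less_trans[OF elim_v_pos m(1)] by simp
  moreover have "ln d \<le> ln u" using u d by simp
  ultimately have "elim_fun A B u < 0" by (simp add: elim_fun_def u M_def)
  then show ?thesis
    using u m d c01 \<open>u \<noteq> c\<close> by (intro bexI[of _ u]) (auto simp: elim_dom_def)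
qed

text \<open>As \<open>u\<close> tends to 1, \<open>elim_v\<close> tends to 0 and
  \<open>-2 ln (elim_v)\<close> dominates. The factor 6 in the threshold is the denominator 12 of
  \<open>ln_elim_v\<close> over 2.\<close>

lemma elim_fun_pos_right:
  assumes c: "c \<in> elim_dom A"
  shows "\<exists>u\<in>elim_dom A. c < u \<and> elim_fun A B u > 0"
proof -
  have c01: "0 < c" "c < 1" "elim_v A c < 1" using c by (auto simp: elim_dom_def)
  have "filterlim (\<lambda>u. - 35 * ln (1 - u) + 2 * ln u) at_top (at_left (1::real))" by real_asymp
  then have "eventually (\<lambda>u. - 35 * ln (1 - u) + 2 * ln u > 6 * (B - 35 * ln (1 - elim_v A c)) - A) (at_left 1)"
    unfolding filterlim_at_top_dense by blast
  moreover have "eventually (\<lambda>u. u \<in> {c<..<1}) (at_left 1)"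
    using c01 by (intro eventually_at_left_real) auto
  ultimately have "eventually (\<lambda>u. - 35 * ln (1 - u) + 2 * ln u > 6 * (B - 35 * ln (1 - elim_v A c)) - A
      \<and> u \<in> {c<..<1}) (at_left (1::real))"
    by eventually_elim auto
  then obtain u where u: "c < u" "u < 1"
      "- 35 * ln (1 - u) + 2 * ln u > 6 * (B - 35 * ln (1 - elim_v A c)) - A"
    using eventually_happens[of _ "at_left (1::real)"] by (auto simp: trivial_limit_at_left_real)
  have "ln (1 - elim_v A c) < ln (1 - elim_v A u)"
    using elim_v_less[of c u A] u c01 by auto
  moreover have "ln u < 0" using u c01 by simp
  ultimately have "elim_fun A B u > 0"
    unfolding elim_fun_def ln_elim_v using u(3) by (simp add: field_simps)
  then show ?thesis
    using u elim_dom_up[of c A u] c by (intro bexI[of _ u]) auto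
qed

text \<open>The signs at \<open>l, c1, c2, c3, c4, h\<close> alternate and \<open>elim_fun\<close>
  is strictly monotone in between, giving exactly five zeros. None is critical, as
  \<open>elim_fun\<close> is nonzero at the \<open>ci\<close>.\<close>

lemma log_E3_imp_five_zeros:
  assumes "(A, B) \<in> log_E3"
  shows "card {u \<in> elim_dom A. elim_fun A B u = 0} = 5"
    and "\<And>u. u \<in> elim_dom A \<Longrightarrow> elim_fun A B u = 0 \<Longrightarrow> elim_v A u \<noteq> crit_v u"
proof -
  obtain c1 c2 c3 c4 where "alternating A B c1 c2 c3 c4"
    using assms by (auto simp: log_E3_def)
  then have c: "0 < c1" "c1 < cusp1" "cusp1 < c2" "c2 < 2/9" "2/9 < c3" "c3 < cusp3" "cusp3 < c4" "c4 < 2/3"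
    "log_a c1 = A" "log_a c2 = A" "log_a c3 = A" "log_a c4 = A" and
    b: "B < log_b c1" "log_b c2 < B" "B < log_b c3" "log_b c4 < B"
    by (auto simp: alternating_def)
  have o: "c1 < c2" "c2 < c3" "c3 < c4" using c by auto
  note sign = log_a_sign[OF c]
  let ?K = "elim_fun A B"
  have dom: "c1 \<in> elim_dom A" "c2 \<in> elim_dom A" "c3 \<in> elim_dom A" "c4 \<in> elim_dom A"
    using c cusp_bounds by (auto intro!: elim_fun_at_crit)
  have K: "?K c1 > 0" "?K c2 < 0" "?K c3 > 0" "?K c4 < 0"
    using c b cusp_bounds elim_fun_at_crit(1)[of _ A B] by auto
  obtain l where l: "l \<in> elim_dom A" "l < c1" "?K l < 0" using elim_fun_neg_left[OF dom(1)] by blast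
  obtain h where h: "h \<in> elim_dom A" "c4 < h" "?K h > 0" using elim_fun_pos_right[OF dom(4)] by blast
  have h1: "h < 1" "0 < l" using h l by (auto simp: elim_dom_def)
  have c_lt: "c1 < 1" "c2 < 1" "c3 < 1" "c4 < 1" using o c by auto
  have sub0: "{p..q} \<subseteq> elim_dom A" if "p \<in> elim_dom A" "q < 1" for p q
    using that elim_dom_up[of p A] by auto
  have sub: "{l..c1} \<subseteq> elim_dom A" "{c1..c2} \<subseteq> elim_dom A" "{c2..c3} \<subseteq> elim_dom A"
    "{c3..c4} \<subseteq> elim_dom A" "{c4..h} \<subseteq> elim_dom A"
    by (intro sub0 l dom h1 c_lt)+
  note cont = sub[THEN elim_fun_cont]
  obtain r1 where r1: "l \<le> r1" "r1 \<le> c1" "?K r1 = 0"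
    using IVT'[of ?K l 0 c1, OF _ _ _ cont(1)] l K by auto
  obtain r2 where r2: "c1 \<le> r2" "r2 \<le> c2" "?K r2 = 0"
    using IVT2'[of ?K c2 0 c1, OF _ _ _ cont(2)] o K by auto
  obtain r3 where r3: "c2 \<le> r3" "r3 \<le> c3" "?K r3 = 0"
    using IVT'[of ?K c2 0 c3, OF _ _ _ cont(3)] o K by auto
  obtain r4 where r4: "c3 \<le> r4" "r4 \<le> c4" "?K r4 = 0"
    using IVT2'[of ?K c4 0 c3, OF _ _ _ cont(4)] o K by auto
  obtain r5 where r5: "c4 \<le> r5" "r5 \<le> h" "?K r5 = 0"
    using IVT'[of ?K c4 0 h, OF _ _ _ cont(5)] h K by auto
  have ne: "?K u = 0 \<Longrightarrow> u \<noteq> c1 \<and> u \<noteq> c2 \<and> u \<noteq> c3 \<and> u \<noteq> c4" for u using K by auto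
  have s: "r1 < c1" "c1 < r2" "r2 < c2" "c2 < r3" "r3 < c3" "c3 < r4" "r4 < c4" "c4 < r5"
    using ne[of r1] ne[of r2] ne[of r3] ne[of r4] ne[of r5] r1 r2 r3 r4 r5 by (auto simp: less_le)
  have uniq: "u = u'" if u: "u \<in> elim_dom A" "u' \<in> elim_dom A" "?K u = 0" "?K u' = 0"
    and piece: "(u < c1 \<and> u' < c1) \<or> (u \<in> {c1<..<c2} \<and> u' \<in> {c1<..<c2}) \<or> (u \<in> {c2<..<c3} \<and> u' \<in> {c2<..<c3})
      \<or> (u \<in> {c3<..<c4} \<and> u' \<in> {c3<..<c4}) \<or> (c4 < u \<and> c4 < u')" for u u'
    using u piece
  proof (induction u u' rule: linorder_wlog)
    case (le u u')
    show ?case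
    proof (rule ccontr)
      assume "u \<noteq> u'"
      then have lt: "u < u'" using le by simp
      have u01: "0 < u" "u' < 1" using le by (auto simp: elim_dom_def)
      consider "u' < c1" | "c1 < u" "u' < c2" | "c2 < u" "u' < c3" | "c3 < u" "u' < c4" | "c4 < u"
        using le by auto
      then have "?K u < ?K u' \<or> ?K u' < ?K u"
      proof cases
        case 1
        then show ?thesis using elim_fun_increasing[of u A u' B] le lt u01 sign(1) by auto
      next
        case 2
        then show ?thesis using elim_fun_decreasing[of u A u' B] le lt u01 c sign(2) by auto
      next
        case 3
        then show ?thesis using elim_fun_increasing[of u A u' B] le lt u01 sign(3) by auto
      next
        case 4
        then show ?thesis using elim_fun_decreasing[of u A u' B] le lt u01 c sign(4) by auto
      next
        case 5
        then show ?thesis using elim_fun_increasing[of u A u' B] le lt u01 sign(5) by auto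
      qed
      then show False using le by simp
    qed
  next
    case (sym u u')
    then show ?case by blast
  qed
  have rdom: "r1 \<in> elim_dom A" "r2 \<in> elim_dom A" "r3 \<in> elim_dom A" "r4 \<in> elim_dom A" "r5 \<in> elim_dom A"
    using sub r1 r2 r3 r4 r5 by auto
  have "{u \<in> elim_dom A. ?K u = 0} = {r1, r2, r3, r4, r5}"
  proof
    show "{r1, r2, r3, r4, r5} \<subseteq> {u \<in> elim_dom A. ?K u = 0}" using rdom r1 r2 r3 r4 r5 by auto
    show "{u \<in> elim_dom A. ?K u = 0} \<subseteq> {r1, r2, r3, r4, r5}"
    proof
      fix u assume "u \<in> {u \<in> elim_dom A. ?K u = 0}"
      then have u: "u \<in> elim_dom A" "?K u = 0" by auto
      consider "u < c1" | "c1 < u" "u < c2" | "c2 < u" "u < c3" | "c3 < u" "u < c4" | "c4 < u"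
        using ne[OF u(2)] by fastforce
      then show "u \<in> {r1, r2, r3, r4, r5}"
      proof cases
        case 1 then show ?thesis using uniq[of u r1] u rdom r1 s by auto
      next
        case 2 then show ?thesis using uniq[of u r2] u rdom r2 s by auto
      next
        case 3 then show ?thesis using uniq[of u r3] u rdom r3 s by auto
      next
        case 4 then show ?thesis using uniq[of u r4] u rdom r4 s by auto
      next
        case 5 then show ?thesis using uniq[of u r5] u rdom r5 s by auto
      qed
    qed
  qed
  then show "card {u \<in> elim_dom A. ?K u = 0} = 5" using s by simp
  fix u assume u: "u \<in> elim_dom A" "?K u = 0"
  then have "0 < u" by (simp add: elim_dom_def)
  show "elim_v A u \<noteq> crit_v u"
  proof
    assume eq: "elim_v A u = crit_v u"
    then have "u < 2/3" using elim_v_gt_crit_v[of u A] by (cases "u < 2/3") auto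
    then have "log_a u = A" using elim_v_crit_v(3)[of u A] eq \<open>0 < u\<close> by simp
    then show False
      using sign[OF \<open>0 < u\<close> \<open>u < 2/3\<close>] ne[OF u(2)] by fastforce
  qed
qed

subsection \<open>Roots of the system\<close>

lemma root3_iff: "root3 a b (x, y) \<longleftrightarrow> x^6 + a * y^3 - y = 0 \<and> y^6 + b * x^3 - x = 0"
  by (simp add: root3_def H3_def)

lemma root3_swap: "root3 b a (prod.swap p) \<longleftrightarrow> root3 a b p"
  by (cases p) (auto simp: root3_iff)

lemma root3_factored:
  assumes "x > 0" "y > 0"
  shows "root3 a b (x, y) \<longleftrightarrow> 1 - x^6 / y = a * y^2 \<and> 1 - y^6 / x = b * x^2"
proof -
  have "x^6 + a * y^3 - y = 0 \<longleftrightarrow> 1 - x^6 / y = a * y^2"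
    "y^6 + b * x^3 - x = 0 \<longleftrightarrow> 1 - y^6 / x = b * x^2"
    using assms by (auto simp: field_simps power2_eq_square power3_eq_cube)
  then show ?thesis by (simp add: root3_iff)
qed

text \<open>With \<open>v = y^6/x\<close> one has \<open>ln u + 6 ln v = 35 ln y\<close>. Combined
  with \<open>1 - u = a y^2\<close> this yields
  \<open>35 ln (1 - u) - 2 ln u - 12 ln v = 35 ln a\<close>; the second equation is its mirror
  image.\<close>

lemma root3_elim:
  assumes a: "a > 0" and b: "b > 0" and xy: "x > 0" "y > 0" and root: "root3 a b (x, y)"
  defines "u \<equiv> x^6 / y"
  shows "u \<in> elim_dom (35 * ln a)" "elim_v (35 * ln a) u = y^6 / x"
    "elim_fun (35 * ln a) (35 * ln b) u = 0"
proof -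
  define v where "v = y^6 / x"
  have uv: "1 - u = a * y^2" "1 - v = b * x^2"
    using root root3_factored[OF xy, of a b] by (auto simp: u_def v_def)
  have pos: "0 < u" "0 < v" "u < 1" "v < 1"
  proof -
    show "0 < u" "0 < v" using xy by (auto simp: u_def v_def)
    have "a * y^2 > 0" "b * x^2 > 0" using a b xy by auto
    then show "u < 1" "v < 1" using uv by linarith+
  qed
  have lnu: "ln (1 - u) = ln a + 2 * ln y" "ln u = 6 * ln x - ln y"
    unfolding uv using a xy by (auto simp: u_def ln_mult ln_div ln_realpow)
  have lnv: "ln (1 - v) = ln b + 2 * ln x" "ln v = 6 * ln y - ln x"
    unfolding uv using b xy by (auto simp: v_def ln_mult ln_div ln_realpow)
  have "elim_v (35 * ln a) u = exp (ln v)"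
    unfolding elim_v_def lnu lnv by (simp add: field_simps)
  then have v: "elim_v (35 * ln a) u = v" using pos by simp
  then show "elim_v (35 * ln a) u = y^6 / x" by (simp add: v_def)
  show "u \<in> elim_dom (35 * ln a)" using pos v by (simp add: elim_dom_def)
  show "elim_fun (35 * ln a) (35 * ln b) u = 0"
    unfolding elim_fun_def v lnv lnu by simp
qed

lemma elim_root3:
  assumes a: "a > 0" and b: "b > 0" and u: "u \<in> elim_dom (35 * ln a)"
    and zero: "elim_fun (35 * ln a) (35 * ln b) u = 0"
  obtains x y where "x > 0" "y > 0" "root3 a b (x, y)" "u = x^6 / y"
proof -
  have u01: "0 < u" "u < 1" and v1: "elim_v (35 * ln a) u < 1" using u by (auto simp: elim_dom_def)
  \<comment> \<open>Solve \<open>1 - u = a y^2\<close> for \<open>y\<close> and then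
    \<open>u = x^6/y\<close> for \<open>x\<close>; the zero of \<open>elim_fun\<close> supplies the
    second equation.\<close>
  define y where "y = sqrt ((1 - u) / a)"
  define x where "x = root 6 (u * y)"
  have y: "y > 0" "y^2 = (1 - u) / a" using u01 a by (auto simp: y_def)
  have x: "x > 0" "x^6 = u * y" using u01 y by (auto simp: x_def)
  have u_eq: "u = x^6 / y" using x y by simp
  have ay: "1 - u = a * y^2" using y a by simp
  have lnu: "ln (1 - u) = ln a + 2 * ln y"
    unfolding ay using a y(1) by (simp add: ln_mult ln_realpow)
  have lnu2: "ln u = 6 * ln x - ln y"
    unfolding u_eq using x(1) y(1) by (simp add: ln_div ln_realpow)
  define v where "v = y^6 / x"
  have "v > 0" using x y by (simp add: v_def)
  have lnv: "ln v = 6 * ln y - ln x"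
    unfolding v_def using x(1) y(1) by (simp add: ln_div ln_realpow)
  have "elim_v (35 * ln a) u = exp (ln v)"
    unfolding elim_v_def lnu lnu2 lnv by (simp add: field_simps)
  then have v: "elim_v (35 * ln a) u = v" using \<open>v > 0\<close> by simp
  have "ln (1 - v) = ln b + 2 * ln x"
    using zero unfolding elim_fun_def v lnv lnu2 by simp
  also have "\<dots> = ln (b * x^2)" using b x(1) by (simp add: ln_mult ln_realpow)
  finally have "1 - v = b * x^2"
    using v v1 b x(1) by (subst (asm) ln_inj_iff) auto
  then have "root3 a b (x, y)"
    unfolding root3_factored[OF x(1) y(1)] using ay u_eq by (simp add: v_def)
  then show thesis using that x y u_eq by blast
qed

text \<open>At a root, \<open>x^5 y^5 = uv\<close> and the off-diagonal entries contribute
  \<open>(2 - 3u)(2 - 3v)\<close>, so the determinant is \<open>27uv + 6(u + v) - 4\<close>.\<close>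

lemma invertible_jac3:
  assumes xy: "x > 0" "y > 0" and root: "root3 a b (x, y)"
  shows "invertible (jac3 a b (x, y)) \<longleftrightarrow> y^6 / x \<noteq> crit_v (x^6 / y)"
proof -
  define u where "u = x^6 / y"
  define v where "v = y^6 / x"
  have uv: "a * y^2 = 1 - u" "b * x^2 = 1 - v"
    using root root3_factored[OF xy, of a b] by (auto simp: u_def v_def)
  have "0 < u" using xy by (simp add: u_def)
  have prod: "x^5 * y^5 = u * v"
    using xy by (simp add: u_def v_def field_simps power_numeral_reduce)
  have "det (jac3 a b (x, y)) = 36 * (x^5 * y^5) - (3 * (a * y^2) - 1) * (3 * (b * x^2) - 1)"
    by (simp add: det_2 jac3_def algebra_simps)
  also have "\<dots> = 27 * u * v + 6 * (u + v) - 4"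
    unfolding uv prod by (simp add: algebra_simps)
  also have "\<dots> = (27 * u + 6) * (v - crit_v u)"
    using \<open>0 < u\<close> by (simp add: crit_v_def field_simps)
  finally show ?thesis
    using \<open>0 < u\<close> by (simp add: invertible_det_nz u_def v_def)
qed

lemma root3_bij:
  assumes a: "a > 0" and b: "b > 0"
  shows "bij_betw (\<lambda>p. fst p ^ 6 / snd p) {p \<in> pos_quadrant. root3 a b p}
     {u \<in> elim_dom (35 * ln a). elim_fun (35 * ln a) (35 * ln b) u = 0}"
  unfolding bij_betw_def
proof
  show "inj_on (\<lambda>p. fst p ^ 6 / snd p) {p \<in> pos_quadrant. root3 a b p}"
  proof (rule inj_onI)
    fix p q assume p: "p \<in> {p \<in> pos_quadrant. root3 a b p}" and q: "q \<in> {p \<in> pos_quadrant. root3 a b p}"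
      and eq: "fst p ^ 6 / snd p = fst q ^ 6 / snd q"
    obtain x y where pxy: "p = (x, y)" "x > 0" "y > 0" using p by (cases p) (auto simp: pos_quadrant_def)
    obtain x' y' where qxy: "q = (x', y')" "x' > 0" "y' > 0" using q by (cases q) (auto simp: pos_quadrant_def)
    have "a * y^2 = a * y'^2"
    proof -
      have "1 - x^6 / y = a * y^2" "1 - x'^6 / y' = a * y'^2"
        using p q root3_factored[OF pxy(2,3), of a b] root3_factored[OF qxy(2,3), of a b]
        unfolding pxy(1) qxy(1) by blast+
      moreover have "x^6 / y = x'^6 / y'" using eq by (simp add: pxy(1) qxy(1))
      ultimately show ?thesis by linarith
    qed
    then have "y = y'" using a pxy qxy by (simp add: power2_eq_iff_nonneg)
    moreover have "x^6 = x'^6" using eq \<open>y = y'\<close> pxy qxy by simp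
    then have "x = x'" using pxy qxy by (simp add: power_eq_iff_eq_base)
    ultimately show "p = q" by (simp add: pxy qxy)
  qed
  show "(\<lambda>p. fst p ^ 6 / snd p) ` {p \<in> pos_quadrant. root3 a b p}
      = {u \<in> elim_dom (35 * ln a). elim_fun (35 * ln a) (35 * ln b) u = 0}"
  proof (intro set_eqI iffI)
    fix u assume "u \<in> (\<lambda>p. fst p ^ 6 / snd p) ` {p \<in> pos_quadrant. root3 a b p}"
    then obtain x y where "x > 0" "y > 0" "root3 a b (x, y)" "u = x^6 / y"
      by (auto simp: pos_quadrant_def)
    then show "u \<in> {u \<in> elim_dom (35 * ln a). elim_fun (35 * ln a) (35 * ln b) u = 0}"
      using root3_elim[OF a b] by auto
  next
    fix u assume "u \<in> {u \<in> elim_dom (35 * ln a). elim_fun (35 * ln a) (35 * ln b) u = 0}"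
    then obtain x y where "x > 0" "y > 0" "root3 a b (x, y)" "u = x^6 / y"
      using elim_root3[OF a b, of u] by auto
    then show "u \<in> (\<lambda>p. fst p ^ 6 / snd p) ` {p \<in> pos_quadrant. root3 a b p}"
      by (intro image_eqI[of _ _ "(x, y)"]) (auto simp: pos_quadrant_def)
  qed
qed

lemma log_E3_roots:
  assumes a: "a > 0" and b: "b > 0" and E: "(35 * ln a, 35 * ln b) \<in> log_E3"
  shows "card {p \<in> pos_quadrant. root3 a b p} = 5"
    and "\<And>p. p \<in> pos_quadrant \<Longrightarrow> root3 a b p \<Longrightarrow> nondegenerate3 a b p"
proof -
  show "card {p \<in> pos_quadrant. root3 a b p} = 5"
    using bij_betw_same_card[OF root3_bij[OF a b]] log_E3_imp_five_zeros(1)[OF E] by simp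
  fix p assume p: "p \<in> pos_quadrant" "root3 a b p"
  obtain x y where xy: "p = (x, y)" "x > 0" "y > 0" using p by (cases p) (auto simp: pos_quadrant_def)
  have root: "root3 a b (x, y)" using p xy by simp
  show "nondegenerate3 a b p"
    unfolding nondegenerate3_def xy(1) invertible_jac3[OF xy(2,3) root]
    using root root3_elim[OF a b xy(2,3) root] log_E3_imp_five_zeros(2)[OF E] by metis
qed

text \<open>\<open>isolated_root3\<close> refers to all roots in the plane; openness of the quadrant
  keeps those outside it away from \<open>p\<close>.\<close>

lemma finite_roots_isolated:
  assumes fin: "finite {p \<in> pos_quadrant. root3 a b p}" and p: "p \<in> pos_quadrant" "root3 a b p"
  shows "isolated_root3 a b p"
proof -
  have "open pos_quadrant"
    unfolding pos_quadrant_def by (auto intro!: open_Collect_conj open_Collect_less continuous_intros)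
  moreover have "closed ({p \<in> pos_quadrant. root3 a b p} - {p})"
    using fin by (intro finite_imp_closed) auto
  ultimately have "open (pos_quadrant - ({p \<in> pos_quadrant. root3 a b p} - {p}))"
    by (rule open_Diff)
  then obtain e where e: "e > 0" "ball p e \<subseteq> pos_quadrant - ({p \<in> pos_quadrant. root3 a b p} - {p})"
    using p(1) open_contains_ball by blast
  have "\<forall>q. root3 a b q \<and> dist q p < e \<longrightarrow> q = p"
  proof (intro allI impI)
    fix q assume q: "root3 a b q \<and> dist q p < e"
    then have "q \<in> ball p e" by (simp add: dist_commute)
    then show "q = p" using e(2) q by blast
  qed
  then show ?thesis using p(2) e(1) unfolding isolated_root3_def by blast
qed

lemma log_E3_imp_E3:
  assumes a: "a > 0" and b: "b > 0" and E: "(35 * ln a, 35 * ln b) \<in> log_E3"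
  shows "(a, b) \<in> E3"
proof -
  let ?R = "{p \<in> pos_quadrant. root3 a b p}"
  have "card ?R = 5" by (rule log_E3_roots(1)[OF assms])
  then have "finite ?R" by (intro card_ge_0_finite) simp
  then show ?thesis
    unfolding E3_def using log_E3_roots(2)[OF assms] finite_roots_isolated[of a b] \<open>card ?R = 5\<close>
    by (intro CollectI case_prodI exI[of _ ?R]) auto
qed

lemma five_sorted:
  fixes S :: "'a::linorder set"
  assumes "finite S" "card S \<ge> 5"
  obtains r1 r2 r3 r4 r5 where "r1 < r2" "r2 < r3" "r3 < r4" "r4 < r5" "{r1, r2, r3, r4, r5} \<subseteq> S"
proof -
  define xs where "xs = sorted_list_of_set S"
  have xs: "sorted_wrt (<) xs" "set xs = S" "length xs \<ge> 5"
    using assms by (auto simp: xs_def)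
  have lt: "xs ! i < xs ! j" if "i < j" "j < 5" for i j
    using sorted_wrt_nth_less[OF xs(1)] that xs(3) by simp
  have "xs ! i \<in> S" if "i < 5" for i using nth_mem[of i xs] that xs by simp
  then show thesis using that[of "xs ! 0" "xs ! 1" "xs ! 2" "xs ! 3" "xs ! 4"] lt by simp
qed

lemma five_roots_imp_log_E3:
  assumes a: "a > 0" and b: "b > 0"
    and R: "finite R" "card R \<ge> 5" "R \<subseteq> {p \<in> pos_quadrant. root3 a b p}"
  shows "(35 * ln a, 35 * ln b) \<in> log_E3"
proof -
  let ?A = "35 * ln a" and ?B = "35 * ln b"
  let ?f = "\<lambda>p::real \<times> real. fst p ^ 6 / snd p"
  have bij: "inj_on ?f {p \<in> pos_quadrant. root3 a b p}"
    "?f ` {p \<in> pos_quadrant. root3 a b p} = {u \<in> elim_dom ?A. elim_fun ?A ?B u = 0}"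
    using root3_bij[OF a b] by (auto simp: bij_betw_def)
  have "card (?f ` R) \<ge> 5" using R card_image[OF inj_on_subset[OF bij(1) R(3)]] by simp
  then obtain r1 r2 r3 r4 r5 where r: "r1 < r2" "r2 < r3" "r3 < r4" "r4 < r5"
    and sub: "{r1, r2, r3, r4, r5} \<subseteq> ?f ` R"
    using five_sorted[of "?f ` R"] R(1) by blast
  have "{r1, r2, r3, r4, r5} \<subseteq> {u \<in> elim_dom ?A. elim_fun ?A ?B u = 0}"
    using sub R(3) bij(2) by blast
  from subsetD[OF this] show ?thesis
    by (intro five_zeros_imp_log_E3[OF r]) (simp_all only: mem_Collect_eq)
qed

text \<open>Swapping the coordinates of the five roots exchanges \<open>a\<close> and
  \<open>b\<close>, so the symmetry is read off from roots instead of branches.\<close>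

lemma log_E3_swap:
  assumes a: "a > 0" and b: "b > 0" and E: "(35 * ln a, 35 * ln b) \<in> log_E3"
  shows "(35 * ln b, 35 * ln a) \<in> log_E3"
proof -
  let ?R = "{p \<in> pos_quadrant. root3 a b p}"
  have "card ?R = 5" by (rule log_E3_roots(1)[OF assms])
  then have "finite (prod.swap ` ?R)" "card (prod.swap ` ?R) = 5"
    by (auto intro: card_ge_0_finite simp: card_image)
  moreover have "prod.swap ` ?R \<subseteq> {p \<in> pos_quadrant. root3 b a p}"
    by (auto simp: pos_quadrant_def root3_iff)
  ultimately show ?thesis using five_roots_imp_log_E3[OF b a] by simp
qed

section \<open>Uniqueness of the positive root when a parameter is nonpositive\<close>

lemma cubic_less:
  fixes a y y' :: real
  assumes "a \<le> 0" "0 < y" "y < y'"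
  shows "y * (1 - a * y^2) < y' * (1 - a * y'^2)"
proof -
  have "y^3 < y'^3" using assms by (intro power_strict_mono) auto
  then have "a * y'^3 \<le> a * y^3" using assms by (intro mult_left_mono_neg) auto
  then show ?thesis using assms by (simp add: algebra_simps power2_eq_square power3_eq_cube)
qed

text \<open>For \<open>a \<le> 0\<close> the quotient \<open>(1 - a y^2)/y^2\<close> does not
  increase with \<open>y\<close>. Dividing the two equations therefore gives
  \<open>(x'/x)^6 \<le> (y'/y)^3\<close>.\<close>

lemma root3_growth:
  fixes a x y x' y' :: real
  assumes a: "a \<le> 0" and pos: "x > 0" "y > 0" "x' > 0" "y' > 0"
    and x6: "x^6 = y * (1 - a * y^2)" "x'^6 = y' * (1 - a * y'^2)" and less: "x < x'"
  shows "y < y'" "(x' / x)^2 \<le> y' / y"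
proof -
  have "x^6 < x'^6" using less pos by (intro power_strict_mono) auto
  then show less_y: "y < y'"
    using cubic_less[of a y' y] a pos x6 by (cases y y' rule: linorder_cases) auto
  have "(x'^2 * y)^3 \<le> (x^2 * y')^3"
  proof -
    have "y^2 * (1 - a * y'^2) \<le> y'^2 * (1 - a * y^2)"
      using less_y pos by (simp add: algebra_simps power_mono)
    then have "y * y' * (y^2 * (1 - a * y'^2)) \<le> y * y' * (y'^2 * (1 - a * y^2))"
      using pos by (intro mult_left_mono) auto
    then have "y^3 * (y' * (1 - a * y'^2)) \<le> y'^3 * (y * (1 - a * y^2))"
      by (simp add: algebra_simps power2_eq_square power3_eq_cube)
    then have "y^3 * x'^6 \<le> y'^3 * x^6" using x6 by simp
    then show ?thesis by (simp add: power_mult_distrib mult.commute flip: power_mult)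
  qed
  then have "x'^2 * y \<le> x^2 * y'"
    using pos by (subst (asm) power_mono_iff) auto
  then show "(x' / x)^2 \<le> y' / y" using pos by (simp add: field_simps)
qed

text \<open>With \<open>X = x'/x > 1\<close> and \<open>Y = y'/y\<close>, growth gives
  \<open>X < X^2 \<le> Y\<close>. For \<open>b \<le> 0\<close> the mirrored bound
  \<open>Y^2 \<le> X\<close> contradicts this. For \<open>b > 0\<close>,
  \<open>y^6/x = 1 - b x^2\<close> would have to decrease, yet \<open>Y^6 > X\<close>.\<close>

lemma root3_nonpos_not_less:
  assumes a: "a \<le> 0" and pos: "x > 0" "y > 0" "x' > 0" "y' > 0"
    and r: "root3 a b (x, y)" "root3 a b (x', y')"
  shows "\<not> x < x'"
proof
  assume less: "x < x'"
  have x6: "x^6 = y * (1 - a * y^2)" "x'^6 = y' * (1 - a * y'^2)"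
    using r unfolding root3_iff by (simp_all add: algebra_simps power2_eq_square power3_eq_cube)
  have y6: "y^6 = x * (1 - b * x^2)" "y'^6 = x' * (1 - b * x'^2)"
    using r unfolding root3_iff by (simp_all add: algebra_simps power2_eq_square power3_eq_cube)
  define X where "X = x' / x"
  define Y where "Y = y' / y"
  have xy': "x' = X * x" "y' = Y * y" using pos by (auto simp: X_def Y_def)
  have X1: "X > 1" using less pos by (simp add: X_def)
  note g = root3_growth[OF a pos x6 less, folded X_def Y_def]
  have "X < X^2" using X1 by (simp add: power2_eq_square)
  then have XY: "X < Y" using g(2) by simp
  show False
  proof (cases "b \<le> 0")
    case True
    have "Y^2 \<le> X"
      using root3_growth(2)[of b y x y' x'] True pos y6 g(1) by (simp add: X_def Y_def)
    moreover have "Y < Y^2" using X1 XY by (simp add: power2_eq_square)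
    ultimately show False using XY by simp
  next
    case False
    have "Y \<le> Y^6" using X1 XY by (intro self_le_power) auto
    then have "X < Y^6" using XY by simp
    then have "X * y^6 < y'^6" using pos by (simp add: xy' power_mult_distrib)
    then have "X * x * (1 - b * x^2) < X * x * (1 - b * x'^2)"
      unfolding y6 by (simp add: xy')
    moreover have "X * x > 0" using X1 pos by simp
    ultimately have "b * x'^2 < b * x^2" by (subst (asm) mult_less_cancel_left_pos) auto
    moreover have "b * x^2 < b * x'^2" using False less pos by (simp add: power_strict_mono)
    ultimately show False by simp
  qed
qed

lemma root3_nonpos_unique:
  assumes a: "a \<le> 0" and "p \<in> pos_quadrant" "q \<in> pos_quadrant" "root3 a b p" "root3 a b q"
  shows "p = q"
proof -
  obtain x y x' y' where pq: "p = (x, y)" "q = (x', y')" by (cases p, cases q) auto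
  have pos: "x > 0" "y > 0" "x' > 0" "y' > 0" and r: "root3 a b (x, y)" "root3 a b (x', y')"
    using assms by (auto simp: pq pos_quadrant_def)
  have "x = x'"
    using root3_nonpos_not_less[OF a pos r] root3_nonpos_not_less[OF a pos(3,4,1,2) r(2,1)] by simp
  have "x^6 = y * (1 - a * y^2)" "x'^6 = y' * (1 - a * y'^2)"
    using r unfolding root3_iff by (simp_all add: algebra_simps power2_eq_square power3_eq_cube)
  then have "y * (1 - a * y^2) = y' * (1 - a * y'^2)" using \<open>x = x'\<close> by simp
  then have "y = y'"
    using cubic_less[OF a pos(2), of y'] cubic_less[OF a pos(4), of y]
    by (cases y y' rule: linorder_cases) auto
  then show ?thesis using \<open>x = x'\<close> by (simp add: pq)
qed

lemma E3_pos:
  assumes "(a, b) \<in> E3"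
  shows "a > 0" "b > 0"
proof -
  obtain R where R: "finite R" "card R \<ge> 5" "\<And>p. p \<in> R \<Longrightarrow> p \<in> pos_quadrant \<and> root3 a b p"
    using assms by (auto simp: E3_def nondegenerate3_def)
  have "\<not> card R \<le> Suc 0" using R(2) by simp
  then obtain p q where pq: "p \<in> R" "q \<in> R" "p \<noteq> q"
    using R(1) card_le_Suc0_iff_eq by blast
  then have pq': "p \<in> pos_quadrant" "q \<in> pos_quadrant" "root3 a b p" "root3 a b q" using R(3) by auto
  show "a > 0"
    using root3_nonpos_unique[of a p q b] pq pq' by (cases "a > 0") auto
  have "prod.swap p \<in> pos_quadrant" "prod.swap q \<in> pos_quadrant"
    using pq' by (auto simp: pos_quadrant_def)
  moreover have "prod.swap p \<noteq> prod.swap q" using pq(3) by (metis swap_swap)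
  ultimately show "b > 0"
    using root3_nonpos_unique[of b "prod.swap p" "prod.swap q" a] pq' root3_swap[of b a]
    by (cases "b > 0") auto
qed

section \<open>Star convexity in the original coordinates\<close>

lemma E3_iff_log_E3: "(a, b) \<in> E3 \<longleftrightarrow> a > 0 \<and> b > 0 \<and> (35 * ln a, 35 * ln b) \<in> log_E3"
proof
  assume E: "(a, b) \<in> E3"
  then obtain R where "finite R" "card R \<ge> 5" "R \<subseteq> {p \<in> pos_quadrant. root3 a b p}"
    by (auto simp: E3_def nondegenerate3_def)
  then show "a > 0 \<and> b > 0 \<and> (35 * ln a, 35 * ln b) \<in> log_E3"
    using five_roots_imp_log_E3[of a b R] E3_pos[OF E] by simp
qed (use log_E3_imp_E3 in blast)

lemma starlike_E3: "starlike E3"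
proof -
  obtain C e1 e3 where e: "0 < e1" "e1 < cusp1" "2/9 < e3" "e3 < cusp3"
      "log_a e1 = C" "log_a e3 = C" "log_b e1 = log_b e3" "C < log_b e1"
    using center_exists[OF log_E3_44_31] by blast
  define c where "c = exp (C / 35)"
  have c: "c > 0" "35 * ln c = C" by (auto simp: c_def)
  note center = e[folded c(2)]
  have "(35 * ln c, 35 * ln c) \<in> log_E3"
    using log_E3_upperI[of C C e1 e3] e c(2) by simp
  then have "(c, c) \<in> E3" using c E3_iff_log_E3 by simp
  moreover have "closed_segment (c, c) q \<subseteq> E3" if "q \<in> E3" for q
  proof
    fix z assume "z \<in> closed_segment (c, c) q"
    then obtain t where t: "0 \<le> t" "t \<le> 1" "z = (1 - t) *\<^sub>R (c, c) + t *\<^sub>R q"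
      by (auto simp: in_segment)
    obtain a b where q: "q = (a, b)" by (cases q)
    then have ab: "a > 0" "b > 0" "(35 * ln a, 35 * ln b) \<in> log_E3"
      using that E3_iff_log_E3 by auto
    define a' where "a' = (1 - t) * c + t * a"
    define b' where "b' = (1 - t) * c + t * b"
    have z: "z = (a', b')" by (simp add: t q a'_def b'_def)
    have pos: "a' > 0" "b' > 0"
      using t c ab by (cases "t = 0"; simp add: a'_def b'_def add_nonneg_pos)+
    have "(35 * ln a', 35 * ln b') \<in> log_E3"
    proof (cases "a \<le> b")
      case True
      then show ?thesis
        using log_E3_star_upper[OF center ab(1,2) c(1) True t(1,2) ab(3)] by (simp add: a'_def b'_def)
    next
      \<comment> \<open>Below the diagonal, reflect the segment; the centre \<open>(c, c)\<close> is
        fixed by the reflection.\<close>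
      case False
      then have "b \<le> a" by simp
      then have "(35 * ln b', 35 * ln a') \<in> log_E3"
        using log_E3_star_upper[OF center ab(2,1) c(1) _ t(1,2) log_E3_swap[OF ab]]
        by (simp add: a'_def b'_def)
      then show ?thesis using log_E3_swap pos by blast
    qed
    then show "z \<in> E3" using z pos E3_iff_log_E3 by simp
  qed
  ultimately show ?thesis unfolding starlike_def by blast
qed

theorem theorem1p5:
  shows "E3 \<noteq> {} \<and> starlike E3 \<and> (44/31, 44/31) \<in> E3 \<and>
         finite {p \<in> pos_quadrant. root3 (44/31) (44/31) p} \<and>
         card {p \<in> pos_quadrant. root3 (44/31) (44/31) p} = 5 \<and>
         (\<forall>p \<in> pos_quadrant. root3 (44/31) (44/31) p \<longrightarrow> nondegenerate3 (44/31) (44/31) p)"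
proof -
  have pos: "(44/31::real) > 0" by simp
  have "(44/31, 44/31) \<in> E3" using log_E3_imp_E3[OF pos pos log_E3_44_31] .
  moreover have card5: "card {p \<in> pos_quadrant. root3 (44/31) (44/31) p} = 5"
    using log_E3_roots(1)[OF pos pos log_E3_44_31] .
  moreover have "finite {p \<in> pos_quadrant. root3 (44/31) (44/31) p}"
    using card5 by (intro card_ge_0_finite) simp
  ultimately show ?thesis
    using starlike_E3 log_E3_roots(2)[OF pos pos log_E3_44_31] by blast
qed

end
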